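(* Let $M\ge 1$ be an integer and let $U\subset\mathbb{R}^{n+1}$ be a bounded slice Cauchy domain. For $\mathrm{j}\in\mathbb{S}$ set $ds_{\mathrm{j}}=ds\,(-\mathrm{j})$ and $\overline{\partial_{\mathrm{j}}}=\frac12(\partial_u+\mathrm{j}\partial_v)$. (I) If $F$ is left poly slice monogenic of order $M$ on an axially symmetric open set containing $\overline U$, then $$F(x)=\frac{1}{2\pi}\int_{\partial(U\cap\mathbb{C}_{\mathrm{j}})}\sum_{\ell=0}^{M-1}\Pi_\ell S_L^{-1}(s,x)\,ds_{\mathrm{j}}\,\overline{\partial_{\mathrm{j}}}^{\,\ell}F(s)\qquad\text{for all }x\in U.$$ (II) If $F$ is right poly slice monogenic of order $M$ on an axially symmetric open set containing $\overline U$, then $$F(x)=\frac{1}{2\pi}\int_{\partial(U\cap\mathbb{C}_{\mathrm{j}})}\sum_{\ell=0}^{M-1}F(s)\overline{\partial_{\mathrm{j}}}^{\,\ell}\,ds_{\mathrm{j}}\,\Pi_\ell S_R^{-1}(s,x)\qquad\text{for all }x\in U.$$ The integrals depend neither on $U$ nor on the imaginary unit $\mathrm{j}\in\mathbb{S}$.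
   Context: $\mathbb{R}_n$ is the real Clifford algebra generated by $e_1,\dots,e_n$ with $e_\ell e_m+e_me_\ell=0$ ($\ell\ne m$), $e_\ell^2=-1$. A point $(x_0,\dots,x_n)\in\mathbb{R}^{n+1}$ is identified with the paravector $x=x_0+\sum_{\ell=1}^n x_\ell e_\ell\in\mathbb{R}_n$; $\mathrm{Re}(x)=x_0$, $\overline{x}=x_0-\sum x_\ell e_\ell$, $|x|^2=\sum_{\ell=0}^n x_\ell^2$. $\mathbb{S}=\{\sum_{\ell=1}^n x_\ell e_\ell:\sum x_\ell^2=1\}$, so $\mathrm{j}^2=-1$ for $\mathrm{j}\in\mathbb{S}$; $\mathbb{C}_{\mathrm{j}}=\mathbb{R}+\mathrm{j}\mathbb{R}$. For $x=x_0+\underline{x}$, $[x]=\{x_0+\mathrm{j}|\underline{x}|:\mathrm{j}\in\mathbb{S}\}$. A set $U\subset\mathbb{R}^{n+1}$ is axially symmetric if $[x]\subset U$ for all $x\in U$. Let $U$ be axially symmetric and open and $\mathcal{U}=\{(u,v)\in\mathbb{R}^2:u+\mathbb{S}v\subset U\}$. A left (right) slice function is $F:U\to\mathbb{R}_n$ with $F(u+\mathrm{j}v)=F_0(u,v)+\mathrm{j}F_1(u,v)$ (resp. $F_0(u,v)+F_1(u,v)\mathrm{j}$) for all $\mathrm{j}\in\mathbb{S}$, where $F_0,F_1:\mathcal{U}\to\mathbb{R}_n$ satisfy $F_0(u,-v)=F_0(u,v)$, $F_1(u,-v)=-F_1(u,v)$. It is left (right) poly slice monogenic of order $M$ if $F_0,F_1$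 are of class $\mathcal{C}^M$ and, for all $\mathrm{j}\in\mathbb{S}$, $\frac{1}{2^M}(\partial_u+\mathrm{j}\partial_v)^M(F_0+\mathrm{j}F_1)=0$ (resp. $(F_0+F_1\mathrm{j})\frac{1}{2^M}(\partial_u+\mathrm{j}\partial_v)^M=0$, with $\mathrm{j}$ multiplying from the right). In the integrals $s=u+\mathrm{j}v\in\mathbb{C}_{\mathrm{j}}$; $\overline{\partial_{\mathrm{j}}}F=\frac12(\partial_uF+\mathrm{j}\,\partial_vF)$ and $F\overline{\partial_{\mathrm{j}}}=\frac12(\partial_uF+(\partial_vF)\mathrm{j})$, applied to the restriction of $F$ to $\mathbb{C}_{\mathrm{j}}$. Kernels, for $s\notin[x]$ and integers $\ell\ge0$: $$\Pi_\ell S_L^{-1}(s,x)=\frac{1}{\ell!}\sum_{k=0}^\ell\binom{\ell}{k}\overline{x}^kS_L^{-1}(s,x)(-\overline{s})^{\ell-k},\qquad \Pi_\ell S_R^{-1}(s,x)=\frac{1}{\ell!}\sum_{k=0}^\ell\binom{\ell}{k}(-\overline{s})^{\ell-k}S_R^{-1}(s,x)\overline{x}^k,$$ with $S_L^{-1}(s,x)=-(x^2-2\mathrm{Re}(s)x+|s|^2)^{-1}(x-\overline{s})$, $S_R^{-1}(s,x)=-(x-\overline{s})(x^2-2\mathrm{Re}(s)x+|s|^2)^{-1}$. A slice Cauchy domain is an axially symmetric open set $U$ such that for every $\mathrm{j}\in\mathbb{S}$ the boundary $\partial(U\cap\mathbb{C}_{\mathrm{j}})$ is a finite union of non-intersecting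 piecewise continuously differentiable Jordan curves, positively oriented with respect to $U\cap\mathbb{C}_{\mathrm{j}}$. *)

theory Defs
  imports "HOL-Complex_Analysis.Complex_Analysis"
begin

section \<open>The real Clifford algebra of negative signature\<close>

text \<open>
  The index type \<^typ>\<open>'n\<close> has the role of \<open>{1, ..., n}\<close>. An element is the family of its
  coordinates in the basis of blades \<open>e\<^sub>A = e\<^sub>i \<cdots> e\<^sub>k\<close>, where \<open>i < \<dots> < k\<close> are the elements of
  \<open>A\<close>; the linear order on \<^typ>\<open>'n\<close> only serves to fix that ordering of the factors.
\<close>

typedef (overloaded) ('n::"{finite,linorder}") clifford = "UNIV :: (real ^ ('n set)) set"
  morphisms coords of_coords
  by simp

declare coords_inverse [simp] of_coords_inverse [OF UNIV_I, simp]

lemma clifford_eq_iff: "x = y \<longleftrightarrow> coords x = coords y"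
  by (simp add: coords_inject)

text \<open>
  Sorting \<open>e\<^sub>A e\<^sub>B\<close> costs one sign for every pair \<open>b < a\<close>, and one further sign for every common
  index, since \<open>e\<^sub>a\<^sup>2 = -1\<close>. What is left is \<open>e\<^sub>C\<close> for the symmetric difference \<open>C\<close>.
\<close>

definition blade_sign :: "'n::{finite,linorder} set \<Rightarrow> 'n set \<Rightarrow> real" where
  "blade_sign A B = (-1) ^ card {(a, b). a \<in> A \<and> b \<in> B \<and> b \<le> a}"

definition blade :: "'n::{finite,linorder} set \<Rightarrow> 'n clifford" where
  "blade A = of_coords (axis A 1)"

definition generator :: "'n::{finite,linorder} \<Rightarrow> 'n clifford" where
  "generator i = blade {i}"

instantiation clifford :: ("{finite,linorder}") real_vector
begin

definition "0 = of_coords 0"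
definition "x + y = of_coords (coords x + coords y)"
definition "- x = of_coords (- coords x)"
definition "x - y = of_coords (coords x - coords y)"
definition "r *\<^sub>R x = of_coords (r *\<^sub>R coords x)"

instance
  by standard
    (auto simp: zero_clifford_def plus_clifford_def uminus_clifford_def minus_clifford_def
      scaleR_clifford_def clifford_eq_iff algebra_simps)

end

lemma coords_simps [simp]:
  "coords 0 = 0" "coords (x + y) = coords x + coords y" "coords (- x) = - coords x"
  "coords (x - y) = coords x - coords y" "coords (r *\<^sub>R x) = r *\<^sub>R coords x"
  by (auto simp: zero_clifford_def plus_clifford_def uminus_clifford_def minus_clifford_def
      scaleR_clifford_def)

instantiation clifford :: ("{finite,linorder}") euclidean_space
begin

definition "inner x y = inner (coords x) (coords y)"
definition "norm x = norm (coords x)"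
definition "dist x y = norm (x - y :: 'a clifford)"
definition "sgn x = x /\<^sub>R norm (x :: 'a clifford)"
definition "Basis = of_coords ` Basis"
definition "uniformity = (INF e\<in>{0<..}. principal {(x, y). dist x (y :: 'a clifford) < e})"
definition "open U = (\<forall>x\<in>U. \<forall>\<^sub>F (x', y) in uniformity. x' = x \<longrightarrow> y \<in> (U :: 'a clifford set))"

instance
proof
  fix x y z :: "'a clifford" and r :: real
  show "dist x y = norm (x - y)" by (rule dist_clifford_def)
  show "sgn x = x /\<^sub>R norm x" by (rule sgn_clifford_def)
  show "inner x y = inner y x" by (simp add: inner_clifford_def inner_commute)
  show "inner (x + y) z = inner x z + inner y z"
    by (simp add: inner_clifford_def inner_add_left)
  show "inner (r *\<^sub>R x) y = r * inner x y" by (simp add: inner_clifford_def)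
  show "0 \<le> inner x x" by (simp add: inner_clifford_def)
  show "(inner x x = 0) = (x = 0)" by (simp add: inner_clifford_def clifford_eq_iff)
  show "norm x = sqrt (inner x x)"
    by (simp add: inner_clifford_def norm_clifford_def norm_eq_sqrt_inner)
next
  fix x y :: "'a clifford"
  show "(Basis :: 'a clifford set) \<noteq> {}" by (simp add: Basis_clifford_def)
  show "finite (Basis :: 'a clifford set)" by (simp add: Basis_clifford_def)
  show "inner x y = (if x = y then 1 else 0)" if "x \<in> Basis" "y \<in> Basis"
    using that by (auto simp: Basis_clifford_def inner_clifford_def inner_Basis clifford_eq_iff)
  show "(\<forall>u\<in>Basis. inner x u = 0) = (x = 0)"
    using euclidean_all_zero_iff[of "coords x"]
    by (simp add: Basis_clifford_def inner_clifford_def clifford_eq_iff)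
qed (simp_all add: uniformity_clifford_def open_clifford_def)

end

lemma blade_sign_sym_diff_left:
  "blade_sign (sym_diff A B) C = blade_sign A C * blade_sign B C"
proof -
  let ?P = "\<lambda>X. {(a, b). a \<in> X \<and> b \<in> C \<and> b \<le> a}"
  have fin: "finite (?P X)" for X by simp
  have eq: "?P (sym_diff A B) = sym_diff (?P A) (?P B)" by auto
  have "card (?P (sym_diff A B)) = card (?P A - ?P B) + card (?P B - ?P A)"
    unfolding eq using fin by (subst card_Un_disjoint) auto
  moreover have "card (?P A) = card (?P A - ?P B) + card (?P A \<inter> ?P B)"
    using fin by (subst card_Un_disjoint[symmetric]) (auto intro!: arg_cong[where f = card])
  moreover have "card (?P B) = card (?P B - ?P A) + card (?P A \<inter> ?P B)"
    using fin by (subst card_Un_disjoint[symmetric]) (auto intro!: arg_cong[where f = card])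
  ultimately show ?thesis
    unfolding blade_sign_def by (simp add: power_add[symmetric] uminus_power_if)
qed

lemma blade_sign_sym_diff_right:
  "blade_sign A (sym_diff B C) = blade_sign A B * blade_sign A C"
proof -
  let ?P = "\<lambda>X. {(a, b). a \<in> A \<and> b \<in> X \<and> b \<le> a}"
  have fin: "finite (?P X)" for X by simp
  have eq: "?P (sym_diff B C) = sym_diff (?P B) (?P C)" by auto
  have "card (?P (sym_diff B C)) = card (?P B - ?P C) + card (?P C - ?P B)"
    unfolding eq using fin by (subst card_Un_disjoint) auto
  moreover have "card (?P B) = card (?P B - ?P C) + card (?P B \<inter> ?P C)"
    using fin by (subst card_Un_disjoint[symmetric]) (auto intro!: arg_cong[where f = card])
  moreover have "card (?P C) = card (?P C - ?P B) + card (?P B \<inter> ?P C)"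
    using fin by (subst card_Un_disjoint[symmetric]) (auto intro!: arg_cong[where f = card])
  ultimately show ?thesis
    unfolding blade_sign_def by (simp add: power_add[symmetric] uminus_power_if)
qed

lemma blade_sign_empty [simp]: "blade_sign {} A = 1" "blade_sign A {} = 1"
  by (simp_all add: blade_sign_def)

instantiation clifford :: ("{finite,linorder}") real_algebra_1
begin

definition "1 = blade ({} :: 'a set)"

text \<open>For given \<open>A\<close> and \<open>C\<close>, the only \<open>B\<close> with \<open>sym_diff A B = C\<close> is \<open>sym_diff A C\<close>.\<close>

definition "x * y = of_coords (\<chi> C. \<Sum>A\<in>UNIV.
  blade_sign A (sym_diff A C) * (coords x $ A) * (coords y $ sym_diff A C))"

instance
proof
  fix x y z :: "'a clifford" and r :: real
  have dd: "sym_diff A (sym_diff A C) = C" for A C :: "'a set" by auto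
  show "x * y * z = x * (y * z)"
  proof -
    have "(\<Sum>B\<in>UNIV. blade_sign B (sym_diff B D) * (\<Sum>A\<in>UNIV. blade_sign A (sym_diff A B) *
            (coords x $ A) * (coords y $ sym_diff A B)) * (coords z $ sym_diff B D)) =
          (\<Sum>A\<in>UNIV. blade_sign A (sym_diff A D) * (coords x $ A) *
            (\<Sum>B\<in>UNIV. blade_sign B (sym_diff B (sym_diff A D)) * (coords y $ B) *
              (coords z $ sym_diff B (sym_diff A D))))" (is "?l = ?r") for D
    proof -
      have "?l = (\<Sum>A\<in>UNIV. \<Sum>B\<in>UNIV. blade_sign B (sym_diff B D) * blade_sign A (sym_diff A B) *
            (coords x $ A) * (coords y $ sym_diff A B) * (coords z $ sym_diff B D))"
        by (subst sum.swap) (simp add: sum_distrib_left sum_distrib_right mult_ac)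
      also have "\<dots> = (\<Sum>A\<in>UNIV. \<Sum>B\<in>UNIV. blade_sign (sym_diff A B) (sym_diff (sym_diff A B) D) *
            blade_sign A B * (coords x $ A) * (coords y $ B) * (coords z $ sym_diff (sym_diff A B) D))"
      proof (rule sum.cong [OF refl])
        fix A :: "'a set"
        show "(\<Sum>B\<in>UNIV. blade_sign B (sym_diff B D) * blade_sign A (sym_diff A B) *
              (coords x $ A) * (coords y $ sym_diff A B) * (coords z $ sym_diff B D)) =
            (\<Sum>B\<in>UNIV. blade_sign (sym_diff A B) (sym_diff (sym_diff A B) D) *
              blade_sign A B * (coords x $ A) * (coords y $ B) * (coords z $ sym_diff (sym_diff A B) D))"
          by (rule sum.reindex_bij_witness[of _ "sym_diff A" "sym_diff A"]) (simp_all only: dd UNIV_I)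
      qed
      also have "\<dots> = ?r"
        unfolding sum_distrib_left
      proof (intro sum.cong refl)
        fix A B :: "'a set"
        let ?E = "sym_diff (sym_diff A B) D"
        have 1: "sym_diff B (sym_diff A D) = ?E" "sym_diff A D = sym_diff B ?E" by auto
        show "blade_sign (sym_diff A B) ?E * blade_sign A B * (coords x $ A) * (coords y $ B) *
            (coords z $ ?E) = blade_sign A (sym_diff A D) * (coords x $ A) *
            (blade_sign B (sym_diff B (sym_diff A D)) * (coords y $ B) *
              (coords z $ sym_diff B (sym_diff A D)))"
          unfolding 1(1) unfolding 1(2) blade_sign_sym_diff_left blade_sign_sym_diff_right
          by (simp add: mult_ac)
      qed
      finally show ?thesis .
    qed
    then show ?thesis
      by (simp add: times_clifford_def clifford_eq_iff vec_eq_iff)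
  qed
  show "(x + y) * z = x * z + y * z" "x * (y + z) = x * y + x * z"
    by (simp_all add: times_clifford_def clifford_eq_iff vec_eq_iff algebra_simps sum.distrib)
  show "r *\<^sub>R x * y = r *\<^sub>R (x * y)" "x * r *\<^sub>R y = r *\<^sub>R (x * y)"
    by (simp_all add: times_clifford_def clifford_eq_iff vec_eq_iff sum_distrib_left mult_ac)
  show "1 * x = x"
  proof -
    have "(\<Sum>A\<in>UNIV. blade_sign A (sym_diff A C) * (axis {} 1 $ A) * (coords x $ sym_diff A C)) =
        (\<Sum>A\<in>UNIV. if A = ({} :: 'a set) then coords x $ C else 0)" for C
      by (intro sum.cong refl) (auto simp: axis_def)
    then show ?thesis
      by (simp add: times_clifford_def one_clifford_def blade_def clifford_eq_iff vec_eq_iff)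
  qed
  show "x * 1 = x"
  proof -
    have "(\<Sum>A\<in>UNIV. blade_sign A (sym_diff A C) * (coords x $ A) * (axis {} 1 $ sym_diff A C)) =
        (\<Sum>A\<in>UNIV. if A = C then coords x $ C else 0)" for C
      by (intro sum.cong refl) (auto simp: axis_def)
    then show ?thesis
      by (simp add: times_clifford_def one_clifford_def blade_def clifford_eq_iff vec_eq_iff)
  qed
  show "(0 :: 'a clifford) \<noteq> 1"
    by (auto simp: one_clifford_def blade_def clifford_eq_iff vec_eq_iff axis_def)
qed

end

lemma blade_mult: "blade A * blade B = blade_sign A B *\<^sub>R blade (sym_diff A B)"
proof -
  have "(\<Sum>X\<in>UNIV. blade_sign X (sym_diff X C) * (axis A 1 $ X) * (axis B 1 $ sym_diff X C)) =
      (\<Sum>X\<in>UNIV. if X = A then blade_sign A B * (axis (sym_diff A B) 1 $ C) else 0)" for C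
    by (intro sum.cong refl) (auto simp: axis_def)
  then show ?thesis
    by (simp add: times_clifford_def blade_def clifford_eq_iff vec_eq_iff)
qed

lemma generator_square: "generator i * generator i = -1"
proof -
  have "{(a, b). a \<in> {i} \<and> b \<in> {i} \<and> b \<le> a} = {(i, i)}" by auto
  then show ?thesis
    by (simp only: generator_def blade_mult blade_sign_def one_clifford_def) simp
qed

lemma blade_insert:
  assumes "\<And>a. a \<in> A \<Longrightarrow> i < a"
  shows "blade (insert i A) = generator i * blade A"
proof -
  have "{(x, y). x \<in> {i} \<and> y \<in> A \<and> y \<le> x} = {}" "sym_diff {i} A = insert i A"
    using assms by force+
  then show ?thesis
    by (simp only: generator_def blade_mult blade_sign_def) simp
qed

lemma generator_anticommute:
  assumes "i \<noteq> j"
  shows "generator i * generator j + generator j * generator i = 0"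
proof -
  have "generator i * generator j + generator j * generator i = 0" if "i < j" for i j :: 'a
  proof -
    have "{(x, y). x \<in> {j} \<and> y \<in> {i} \<and> y \<le> x} = {(j, i)}" using that by auto
    then have "generator j * generator i = - blade (sym_diff {j} {i})"
      by (simp only: generator_def blade_mult blade_sign_def) simp
    moreover have "{(x, y). x \<in> {i} \<and> y \<in> {j} \<and> y \<le> x} = {}" using that by auto
    then have "generator i * generator j = blade (sym_diff {i} {j})"
      by (simp only: generator_def blade_mult blade_sign_def) simp
    ultimately show ?thesis by (simp add: Un_commute)
  qed
  from this[of i j] this[of j i] assms show ?thesis
    by (cases "i < j") (auto simp: add.commute)
qed

text \<open>Used only for invertible arguments; inverses in an associative algebra are unique.\<close>

definition clifford_inverse :: "'n::{finite,linorder} clifford \<Rightarrow> 'n clifford" where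
  "clifford_inverse a = (THE b. a * b = 1 \<and> b * a = 1)"


section \<open>Paravectors and axially symmetric sets\<close>

text \<open>
  A point of \<open>\<real>\<^sup>n\<^sup>+\<^sup>1\<close> is the pair of its real part \<open>x\<^sub>0\<close> and the vector \<open>(x\<^sub>1, ..., x\<^sub>n)\<close>.
\<close>

type_synonym 'n point = "real \<times> (real ^ 'n)"

definition paravector :: "'n::{finite,linorder} point \<Rightarrow> 'n clifford" where
  "paravector x = of_real (fst x) + (\<Sum>i\<in>UNIV. (snd x $ i) *\<^sub>R generator i)"

definition conj_point :: "'n::finite point \<Rightarrow> 'n point" where
  "conj_point x = (fst x, - snd x)"

abbreviation imag_units :: "(real ^ 'n::finite) set" where
  "imag_units \<equiv> sphere 0 1"

definition imag_unit :: "real ^ 'n::{finite,linorder} \<Rightarrow> 'n clifford" where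
  "imag_unit j = paravector (0, j)"

text \<open>
  The plane \<open>\<real>\<^sup>2\<close> of pairs \<open>(u, v)\<close> is represented by \<^typ>\<open>complex\<close>; \<open>slice_point j\<close> is the
  isomorphism \<open>u + \<i>v \<mapsto> u + jv\<close> onto \<open>\<complex>\<^sub>j\<close>.
\<close>

definition slice_point :: "real ^ 'n::finite \<Rightarrow> complex \<Rightarrow> 'n point" where
  "slice_point j z = (Re z, Im z *\<^sub>R j)"

definition axial_sphere :: "'n::finite point \<Rightarrow> 'n point set" where
  "axial_sphere x = {(fst x, norm (snd x) *\<^sub>R j) | j. j \<in> imag_units}"

definition axially_symmetric :: "'n::finite point set \<Rightarrow> bool" where
  "axially_symmetric U \<longleftrightarrow> (\<forall>x\<in>U. axial_sphere x \<subseteq> U)"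

definition plane_domain :: "'n::finite point set \<Rightarrow> complex set" where
  "plane_domain U = {z. \<forall>j\<in>imag_units. slice_point j z \<in> U}"

definition slice :: "'n::finite point set \<Rightarrow> real ^ 'n \<Rightarrow> complex set" where
  "slice U j = {z. slice_point j z \<in> U}"


section \<open>Poly slice monogenic functions\<close>

definition du :: "(complex \<Rightarrow> 'a::real_normed_vector) \<Rightarrow> complex \<Rightarrow> 'a" where
  "du f z = vector_derivative (\<lambda>t. f (Complex t (Im z))) (at (Re z))"

definition dv :: "(complex \<Rightarrow> 'a::real_normed_vector) \<Rightarrow> complex \<Rightarrow> 'a" where
  "dv f z = vector_derivative (\<lambda>t. f (Complex (Re z) t)) (at (Im z))"

text \<open>Class \<open>C\<^sup>k\<close> on an open set: all partial derivatives up to order \<open>k\<close> exist and are continuous.\<close>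

fun class_C :: "nat \<Rightarrow> complex set \<Rightarrow> (complex \<Rightarrow> 'a::real_normed_vector) \<Rightarrow> bool" where
  "class_C 0 S f \<longleftrightarrow> continuous_on S f"
| "class_C (Suc k) S f \<longleftrightarrow> continuous_on S f \<and>
     (\<forall>z\<in>S. (\<lambda>t. f (Complex t (Im z))) differentiable at (Re z) \<and>
            (\<lambda>t. f (Complex (Re z) t)) differentiable at (Im z)) \<and>
     class_C k S (du f) \<and> class_C k S (dv f)"

definition cr_left ::
  "real ^ 'n::{finite,linorder} \<Rightarrow> (complex \<Rightarrow> 'n clifford) \<Rightarrow> complex \<Rightarrow> 'n clifford" where
  "cr_left j f = (\<lambda>z. du f z + imag_unit j * dv f z)"

definition cr_right ::
  "real ^ 'n::{finite,linorder} \<Rightarrow> (complex \<Rightarrow> 'n clifford) \<Rightarrow> complex \<Rightarrow> 'n clifford" where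
  "cr_right j f = (\<lambda>z. du f z + dv f z * imag_unit j)"

definition dbar_left ::
  "real ^ 'n::{finite,linorder} \<Rightarrow> (complex \<Rightarrow> 'n clifford) \<Rightarrow> complex \<Rightarrow> 'n clifford" where
  "dbar_left j f = (\<lambda>z. (1/2) *\<^sub>R cr_left j f z)"

definition dbar_right ::
  "real ^ 'n::{finite,linorder} \<Rightarrow> (complex \<Rightarrow> 'n clifford) \<Rightarrow> complex \<Rightarrow> 'n clifford" where
  "dbar_right j f = (\<lambda>z. (1/2) *\<^sub>R cr_right j f z)"

text \<open>
  A function on \<open>U\<close> is a total function of which only the values on \<open>U\<close> matter; likewise for the
  components \<open>F\<^sub>0\<close>, \<open>F\<^sub>1\<close> on \<open>plane_domain U\<close>. The reflection \<open>(u, v) \<mapsto> (u, -v)\<close> is \<^const>\<open>cnj\<close>.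
\<close>

definition even_odd_on :: "complex set \<Rightarrow> (complex \<Rightarrow> 'a::real_vector) \<Rightarrow> (complex \<Rightarrow> 'a) \<Rightarrow> bool" where
  "even_odd_on D F0 F1 \<longleftrightarrow> (\<forall>z\<in>D. F0 (cnj z) = F0 z \<and> F1 (cnj z) = - F1 z)"

definition left_slice_function ::
  "'n::{finite,linorder} point set \<Rightarrow> ('n point \<Rightarrow> 'n clifford) \<Rightarrow>
   (complex \<Rightarrow> 'n clifford) \<Rightarrow> (complex \<Rightarrow> 'n clifford) \<Rightarrow> bool" where
  "left_slice_function U F F0 F1 \<longleftrightarrow> even_odd_on (plane_domain U) F0 F1 \<and>
     (\<forall>z\<in>plane_domain U. \<forall>j\<in>imag_units. F (slice_point j z) = F0 z + imag_unit j * F1 z)"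

definition right_slice_function ::
  "'n::{finite,linorder} point set \<Rightarrow> ('n point \<Rightarrow> 'n clifford) \<Rightarrow>
   (complex \<Rightarrow> 'n clifford) \<Rightarrow> (complex \<Rightarrow> 'n clifford) \<Rightarrow> bool" where
  "right_slice_function U F F0 F1 \<longleftrightarrow> even_odd_on (plane_domain U) F0 F1 \<and>
     (\<forall>z\<in>plane_domain U. \<forall>j\<in>imag_units. F (slice_point j z) = F0 z + F1 z * imag_unit j)"

definition left_poly_slice_monogenic ::
  "nat \<Rightarrow> 'n::{finite,linorder} point set \<Rightarrow> ('n point \<Rightarrow> 'n clifford) \<Rightarrow> bool" where
  "left_poly_slice_monogenic M U F \<longleftrightarrow> (\<exists>F0 F1. left_slice_function U F F0 F1 \<and>
     class_C M (plane_domain U) F0 \<and> class_C M (plane_domain U) F1 \<and>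
     (\<forall>j\<in>imag_units. \<forall>z\<in>plane_domain U.
        (1 / 2 ^ M) *\<^sub>R (cr_left j ^^ M) (\<lambda>w. F0 w + imag_unit j * F1 w) z = 0))"

definition right_poly_slice_monogenic ::
  "nat \<Rightarrow> 'n::{finite,linorder} point set \<Rightarrow> ('n point \<Rightarrow> 'n clifford) \<Rightarrow> bool" where
  "right_poly_slice_monogenic M U F \<longleftrightarrow> (\<exists>F0 F1. right_slice_function U F F0 F1 \<and>
     class_C M (plane_domain U) F0 \<and> class_C M (plane_domain U) F1 \<and>
     (\<forall>j\<in>imag_units. \<forall>z\<in>plane_domain U.
        (1 / 2 ^ M) *\<^sub>R (cr_right j ^^ M) (\<lambda>w. F0 w + F1 w * imag_unit j) z = 0))"


section \<open>Kernels\<close>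

definition kernel_denominator ::
  "'n::{finite,linorder} point \<Rightarrow> 'n point \<Rightarrow> 'n clifford" where
  "kernel_denominator s x =
     paravector x ^ 2 - (2 * fst s) *\<^sub>R paravector x + of_real ((norm s)\<^sup>2)"

definition SL_inv :: "'n::{finite,linorder} point \<Rightarrow> 'n point \<Rightarrow> 'n clifford" where
  "SL_inv s x = - (clifford_inverse (kernel_denominator s x) *
                   (paravector x - paravector (conj_point s)))"

definition SR_inv :: "'n::{finite,linorder} point \<Rightarrow> 'n point \<Rightarrow> 'n clifford" where
  "SR_inv s x = - ((paravector x - paravector (conj_point s)) *
                   clifford_inverse (kernel_denominator s x))"

definition Pi_SL :: "nat \<Rightarrow> 'n::{finite,linorder} point \<Rightarrow> 'n point \<Rightarrow> 'n clifford" where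
  "Pi_SL l s x = (1 / fact l) *\<^sub>R (\<Sum>k\<le>l. real (l choose k) *\<^sub>R
     (paravector (conj_point x) ^ k * SL_inv s x * (- paravector (conj_point s)) ^ (l - k)))"

definition Pi_SR :: "nat \<Rightarrow> 'n::{finite,linorder} point \<Rightarrow> 'n point \<Rightarrow> 'n clifford" where
  "Pi_SR l s x = (1 / fact l) *\<^sub>R (\<Sum>k\<le>l. real (l choose k) *\<^sub>R
     ((- paravector (conj_point s)) ^ (l - k) * SR_inv s x * paravector (conj_point x) ^ k))"


section \<open>Slice Cauchy domains and the Cauchy integrals\<close>

text \<open>
  \<open>\<Gamma>\<close> is a set of parametrisations of the boundary curves of the planar set \<open>D\<close>. Positive
  orientation with respect to \<open>D\<close> (the set lies to the left of its boundary) is expressed for the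
  boundary as a whole: it winds once around every point of \<open>D\<close> and does not wind around the points
  outside the closure of \<open>D\<close>. Hence holes are run through clockwise, and a curve with \<open>D\<close> on both of
  its sides is excluded.
\<close>

definition positively_oriented_boundary :: "complex set \<Rightarrow> (real \<Rightarrow> complex) set \<Rightarrow> bool" where
  "positively_oriented_boundary D \<Gamma> \<longleftrightarrow>
     finite \<Gamma> \<and>
     (\<forall>\<gamma>\<in>\<Gamma>. valid_path \<gamma> \<and> simple_path \<gamma> \<and> pathfinish \<gamma> = pathstart \<gamma>) \<and>
     pairwise (\<lambda>\<gamma> \<delta>. disjnt (path_image \<gamma>) (path_image \<delta>)) \<Gamma> \<and>
     frontier D = (\<Union>\<gamma>\<in>\<Gamma>. path_image \<gamma>) \<and>
     (\<forall>z. z \<notin> frontier D \<longrightarrow> (\<Sum>\<gamma>\<in>\<Gamma>. winding_number \<gamma> z) = (if z \<in> D then 1 else 0))"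

definition slice_Cauchy_domain :: "'n::finite point set \<Rightarrow> bool" where
  "slice_Cauchy_domain U \<longleftrightarrow> axially_symmetric U \<and> open U \<and>
     (\<forall>j\<in>imag_units. \<exists>\<Gamma>. positively_oriented_boundary (slice U j) \<Gamma>)"

text \<open>
  In a form \<open>\<omega> z w\<close> the argument \<open>z\<close> is the point of the curve and \<open>w\<close> its velocity there, both in
  the coordinates \<open>(u, v)\<close> of the slice; the Clifford-valued factors do not commute, so \<open>ds\<^sub>j\<close> must
  stay between the kernel and the derivative of \<open>F\<close>.
\<close>

definition form_integrable_on_curves ::
  "(real \<Rightarrow> complex) set \<Rightarrow> (complex \<Rightarrow> complex \<Rightarrow> 'a::banach) \<Rightarrow> bool" where
  "form_integrable_on_curves \<Gamma> \<omega> \<longleftrightarrow>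
     (\<forall>\<gamma>\<in>\<Gamma>. (\<lambda>t. \<omega> (\<gamma> t) (vector_derivative \<gamma> (at t within {0..1}))) integrable_on {0..1})"

definition form_integral_on_curves ::
  "(real \<Rightarrow> complex) set \<Rightarrow> (complex \<Rightarrow> complex \<Rightarrow> 'a::banach) \<Rightarrow> 'a" where
  "form_integral_on_curves \<Gamma> \<omega> =
     (\<Sum>\<gamma>\<in>\<Gamma>. integral {0..1} (\<lambda>t. \<omega> (\<gamma> t) (vector_derivative \<gamma> (at t within {0..1}))))"

definition ds_unit :: "real ^ 'n::{finite,linorder} \<Rightarrow> complex \<Rightarrow> 'n clifford" where
  "ds_unit j w = paravector (slice_point j w) * (- imag_unit j)"

definition left_Cauchy_form ::
  "nat \<Rightarrow> ('n point \<Rightarrow> 'n clifford) \<Rightarrow> real ^ 'n::{finite,linorder} \<Rightarrow> 'n point \<Rightarrow>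
   complex \<Rightarrow> complex \<Rightarrow> 'n clifford" where
  "left_Cauchy_form M F j x z w =
     (\<Sum>l<M. Pi_SL l (slice_point j z) x * ds_unit j w *
             (dbar_left j ^^ l) (\<lambda>\<zeta>. F (slice_point j \<zeta>)) z)"

definition right_Cauchy_form ::
  "nat \<Rightarrow> ('n point \<Rightarrow> 'n clifford) \<Rightarrow> real ^ 'n::{finite,linorder} \<Rightarrow> 'n point \<Rightarrow>
   complex \<Rightarrow> complex \<Rightarrow> 'n clifford" where
  "right_Cauchy_form M F j x z w =
     (\<Sum>l<M. (dbar_right j ^^ l) (\<lambda>\<zeta>. F (slice_point j \<zeta>)) z * ds_unit j w *
             Pi_SR l (slice_point j z) x)"

end

theory Submission
  imports Defs
begin

text \<open>
  In a fixed plane \<open>\<complex>\<^sub>j\<close> the theorem is a statement about polyanalytic functions. For \<open>s\<close> and \<open>p\<close> in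
  that plane the kernel \<open>\<Pi>\<^sub>\<ell> S\<inverse>(s, p)\<close> is \<open>(cnj p - cnj s)\<^sup>\<ell> / (\<ell>! (s - p))\<close>, so the integrand is the
  ordinary Cauchy kernel applied to

    \<open>G(s) = \<Sum>\<^sub>\<ell> (cnj p - cnj s)\<^sup>\<ell> / \<ell>! \<partial>\<^sub>j\<^sup>\<ell> F(s)\<close>,

  where \<open>\<partial>\<^sub>j\<close> stands for the conjugate derivative.
  This is the Taylor polynomial of \<open>F\<close> in the conjugate variable, centred at \<open>s\<close> and evaluated at \<open>p\<close>.
  Its conjugate derivative in \<open>s\<close> telescopes to a multiple of \<open>\<partial>\<^sub>j\<^sup>M F\<close>, which is zero
  (\<open>conj_taylor_has_derivative\<close>). So \<open>G\<close> is holomorphic, \<open>G(p) = F(p)\<close>, and Cauchy's formula gives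
  the claim for \<open>p\<close> (\<open>polyanalytic_Cauchy_formula\<close>). Left and right multiplication by \<open>j\<close> are
  treated together as a linear map \<open>J\<close> with \<open>J \<circ> J = - id\<close>; complex linear functionals reduce
  the vector-valued formula to the scalar one.

  The boundary consists of several curves, so Cauchy's theorem is needed for cycles. It is reduced to
  a single closed path by joining the curves within each component of the domain
  (\<open>Cauchy_theorem_boundary\<close>); that the curves in one component alone already wind zero times around
  the points outside this component is \<open>winding_number_boundary_in_component\<close>.

  A point \<open>x = u + iv\<close> of another plane is reached by the representation formula
  \<open>f(u + iv) = \<alpha> f(u + jv) + \<beta> f(u - jv)\<close> with \<open>\<alpha> = (1 - ij) / 2\<close> and \<open>\<beta> = (1 + ij) / 2\<close>. It holds for
  the left slice function \<open>F\<close> and also for the kernels as functions of \<open>x\<close> (\<open>Pi_SL_slice_points\<close>), so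
  the formula for \<open>x\<close> is the same combination of the formulas for two points of \<open>\<complex>\<^sub>j\<close>; on the
  right the factors change sides. Finally, the value \<open>2\<pi> F(x)\<close> of the integral involves neither the
  domain nor \<open>j\<close>, which is the asserted independence.
\<close>

section \<open>Cauchy's integral formula for boundaries consisting of several curves\<close>

text \<open>
  The general Cauchy theorem for a single closed path becomes available for several curves once they
  are strung together: each new curve is visited along a connecting path inside the connected open
  set, and the connecting path, run through in both directions, contributes nothing.
\<close>

lemma closed_curves_joined:
  assumes C: "open C" "connected C" "C \<noteq> {}"
    and "finite \<Gamma>"
    and \<Gamma>: "\<And>\<gamma>. \<gamma> \<in> \<Gamma> \<Longrightarrow> valid_path \<gamma> \<and> pathfinish \<gamma> = pathstart \<gamma> \<and> path_image \<gamma> \<subseteq> C"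
  obtains p where "valid_path p" "pathfinish p = pathstart p" "path_image p \<subseteq> C"
    "\<And>f. f holomorphic_on C \<Longrightarrow> contour_integral p f = (\<Sum>\<gamma>\<in>\<Gamma>. contour_integral \<gamma> f)"
proof -
  have "\<exists>p. valid_path p \<and> pathfinish p = pathstart p \<and> path_image p \<subseteq> C \<and>
      (\<forall>f. f holomorphic_on C \<longrightarrow> contour_integral p f = (\<Sum>\<gamma>\<in>\<Gamma>. contour_integral \<gamma> f))"
    using \<open>finite \<Gamma>\<close> \<Gamma>
  proof (induction \<Gamma> rule: finite_induct)
    case empty
    from C(3) obtain a where "a \<in> C" by blast
    then show ?case
      by (intro exI[of _ "linepath a a"] conjI valid_path_linepath)
        (simp_all only: pathstart_linepath pathfinish_linepath path_image_linepath
          closed_segment_idem contour_integral_trivial sum.empty, simp_all)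
  next
    case (insert \<gamma> \<Gamma>)
    then obtain p where p: "valid_path p" "pathfinish p = pathstart p" "path_image p \<subseteq> C"
      and pint: "\<And>f. f holomorphic_on C \<Longrightarrow> contour_integral p f = (\<Sum>\<gamma>\<in>\<Gamma>. contour_integral \<gamma> f)"
      by (metis insertCI)
    have g: "valid_path \<gamma>" "pathfinish \<gamma> = pathstart \<gamma>" "path_image \<gamma> \<subseteq> C"
      using insert.prems by auto
    have "pathstart p \<in> C" "pathstart \<gamma> \<in> C"
      using p g by (meson pathstart_in_path_image subsetD)+
    then obtain q where q: "polynomial_function q" "path_image q \<subseteq> C"
        "pathstart q = pathstart p" "pathfinish q = pathstart \<gamma>"
      using connected_open_polynomial_connected[OF C(1,2)] by metis
    have vq: "valid_path q" by (rule valid_path_polynomial_function[OF q(1)])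
    let ?P = "p +++ q +++ \<gamma> +++ reversepath q"
    have "valid_path ?P" "pathfinish ?P = pathstart ?P" "path_image ?P \<subseteq> C"
      using p g q vq by (auto simp: path_image_join)
    moreover have "contour_integral ?P f = (\<Sum>\<gamma>\<in>insert \<gamma> \<Gamma>. contour_integral \<gamma> f)"
      if f: "f holomorphic_on C" for f
    proof -
      have i: "f contour_integrable_on p" "f contour_integrable_on q" "f contour_integrable_on \<gamma>"
          "f contour_integrable_on (reversepath q)"
        using contour_integrable_holomorphic_simple[OF f C(1)] p g q vq by auto
      have "contour_integral ?P f = contour_integral p f + (contour_integral q f +
          (contour_integral \<gamma> f + contour_integral (reversepath q) f))"
        using i p g q vq by simp
      also have "\<dots> = contour_integral p f + contour_integral \<gamma> f"
        using vq by (simp add: contour_integral_reversepath)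
      finally show ?thesis using pint[OF f] insert.hyps by simp
    qed
    ultimately show ?case by blast
  qed
  then show thesis using that by blast
qed

text \<open>
  Winding numbers are integrals of \<open>1 / (z - w)\<close>, so the joined path inherits them from the curves.
\<close>

lemma Cauchy_theorem_cycle_connected:
  assumes C: "open C" "connected C" and "finite \<Gamma>"
    and \<Gamma>: "\<And>\<gamma>. \<gamma> \<in> \<Gamma> \<Longrightarrow> valid_path \<gamma> \<and> pathfinish \<gamma> = pathstart \<gamma> \<and> path_image \<gamma> \<subseteq> C"
    and zero: "\<And>w. w \<notin> C \<Longrightarrow> (\<Sum>\<gamma>\<in>\<Gamma>. winding_number \<gamma> w) = 0"
    and f: "f holomorphic_on C"
  shows "(\<Sum>\<gamma>\<in>\<Gamma>. contour_integral \<gamma> f) = 0"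
proof (cases "C = {}")
  case True
  then have "\<Gamma> = {}" using \<Gamma> path_image_nonempty by fastforce
  then show ?thesis by simp
next
  case False
  obtain p where p: "valid_path p" "pathfinish p = pathstart p" "path_image p \<subseteq> C"
    and int: "\<And>f. f holomorphic_on C \<Longrightarrow> contour_integral p f = (\<Sum>\<gamma>\<in>\<Gamma>. contour_integral \<gamma> f)"
    using closed_curves_joined[OF C False \<open>finite \<Gamma>\<close> \<Gamma>] by blast
  have "winding_number p w = 0" if w: "w \<notin> C" for w
  proof -
    have "(\<lambda>z. 1 / (z - w)) holomorphic_on C"
      using w by (auto intro!: holomorphic_intros)
    moreover have "w \<notin> path_image \<gamma>" if "\<gamma> \<in> \<Gamma>" for \<gamma> using \<Gamma>[OF that] w by blast
    moreover have "w \<notin> path_image p" using p w by blast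
    ultimately have "winding_number p w = (\<Sum>\<gamma>\<in>\<Gamma>. winding_number \<gamma> w)"
      using p \<Gamma> by (simp add: winding_number_valid_path int sum_distrib_left)
    then show ?thesis using zero[OF w] by simp
  qed
  then have "(f has_contour_integral 0) p"
    using Cauchy_theorem_global[OF C(1) f p(1,2,3)] by blast
  then show ?thesis
    using int[OF f] by (simp add: contour_integral_unique)
qed

text \<open>
  Curves in different components of the domain of holomorphy cannot be joined, so each component has
  to satisfy the hypothesis on winding numbers separately, although only their total is prescribed.
  The reason why it does: off \<open>closure D\<close> the total vanishes, so on \<open>C - closure D\<close> the contribution of the
  curves in \<open>C\<close> is minus the contribution of the other curves, which has no jumps inside \<open>C\<close>.
  Gluing the two gives a continuous integer-valued function on the whole plane, which is
  constant, and it vanishes far away.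
\<close>

lemma winding_number_boundary_in_component:
  assumes \<Omega>: "open \<Omega>" and D: "bounded D" "closure D \<subseteq> \<Omega>"
    and bd: "positively_oriented_boundary D \<Gamma>"
    and C: "C \<in> components \<Omega>" and w: "w \<notin> C"
  shows "(\<Sum>\<gamma>\<in>{\<gamma>\<in>\<Gamma>. path_image \<gamma> \<subseteq> C}. winding_number \<gamma> w) = 0"
proof -
  define GC where "GC = {\<gamma>\<in>\<Gamma>. path_image \<gamma> \<subseteq> C}"
  define GR where "GR = \<Gamma> - GC"
  have fin: "finite \<Gamma>" "finite GC" "finite GR"
    using bd by (auto simp: positively_oriented_boundary_def GC_def GR_def)
  have pth: "path \<gamma>" "pathfinish \<gamma> = pathstart \<gamma>" "path_image \<gamma> \<subseteq> closure D" if "\<gamma> \<in> \<Gamma>" for \<gamma>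
    using bd that by (auto simp: positively_oriented_boundary_def valid_path_imp_path frontier_def)
  have wn: "(\<Sum>\<gamma>\<in>GC. winding_number \<gamma> z) + (\<Sum>\<gamma>\<in>GR. winding_number \<gamma> z) = 0" if "z \<notin> closure D" for z
  proof -
    have "(\<Sum>\<gamma>\<in>GC. winding_number \<gamma> z) + (\<Sum>\<gamma>\<in>GR. winding_number \<gamma> z) = (\<Sum>\<gamma>\<in>\<Gamma>. winding_number \<gamma> z)"
      using fin by (subst sum.union_disjoint[symmetric]) (auto simp: GC_def GR_def intro!: sum.cong)
    also have "z \<notin> frontier D" "z \<notin> D"
      using that closure_subset by (auto simp: frontier_def)
    then have "(\<Sum>\<gamma>\<in>\<Gamma>. winding_number \<gamma> z) = 0"
      using bd by (auto simp: positively_oriented_boundary_def)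
    finally show ?thesis .
  qed
  have oC: "open C" by (rule open_components[OF \<Omega> C])
  have R: "path_image \<gamma> \<inter> C = {}" if "\<gamma> \<in> GR" for \<gamma>
  proof (rule ccontr)
    assume "path_image \<gamma> \<inter> C \<noteq> {}"
    moreover have "connected (path_image \<gamma>)" "path_image \<gamma> \<subseteq> \<Omega>"
      using that pth[of \<gamma>] D by (auto simp: GR_def connected_path_image)
    ultimately have "path_image \<gamma> \<subseteq> C"
      using components_maximal[OF C, of "path_image \<gamma>"] by (simp add: Int_commute)
    then show False using that by (auto simp: GR_def GC_def)
  qed
  have R': "z \<notin> path_image \<gamma>" if "\<gamma> \<in> \<Gamma>" "\<gamma> \<notin> GC" "z \<in> C" for \<gamma> z
    using R[of \<gamma>] that by (auto simp: GR_def)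
  define K where "K = closure (D \<inter> C)"
  \<comment> \<open>A component is closed relative to \<open>\<Omega>\<close>, and \<open>closure D\<close> stays inside \<open>\<Omega>\<close>; hence \<open>D \<inter> C\<close>
    does not approach the boundary of \<open>C\<close>, and \<open>C\<close> and \<open>- K\<close> cover the plane.\<close>
  have KC: "K \<subseteq> C"
  proof -
    from closedin_component[OF C] obtain T where T: "closed T" "C = \<Omega> \<inter> T"
      by (auto simp: closedin_closed)
    have "K \<subseteq> closure D" "K \<subseteq> T"
      unfolding K_def by (intro closure_mono closure_minimal; use T in blast)+
    then show ?thesis using D T by blast
  qed
  have CK: "C \<inter> closure D \<subseteq> K"
    using open_Int_closure_subset[OF oC, of D] by (simp add: K_def Int_commute)
  define h where "h z = (if z \<in> C then - (\<Sum>\<gamma>\<in>GR. winding_number \<gamma> z)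
      else (\<Sum>\<gamma>\<in>GC. winding_number \<gamma> z))" for z
  have hK: "h z = (\<Sum>\<gamma>\<in>GC. winding_number \<gamma> z)" if "z \<notin> K" for z
  proof (cases "z \<in> C")
    case True
    with that CK have "z \<notin> closure D" by blast
    from wn[OF this] show ?thesis using True by (simp add: h_def neg_eq_iff_add_eq_0 add.commute)
  qed (simp add: h_def)
  have "continuous_on C h"
  proof -
    have "continuous_on C (\<lambda>z. - (\<Sum>\<gamma>\<in>GR. winding_number \<gamma> z))"
      using pth R' by (intro continuous_intros continuous_on_subset[OF continuous_on_winding_number])
        (auto simp: GR_def)
    then show ?thesis by (rule continuous_on_eq) (simp add: h_def)
  qed
  moreover have "continuous_on (- K) h"
  proof -
    have "path_image \<gamma> \<subseteq> K" if "\<gamma> \<in> GC" for \<gamma>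
      using that pth[of \<gamma>] CK by (auto simp: GC_def)
    then have "continuous_on (- K) (\<lambda>z. \<Sum>\<gamma>\<in>GC. winding_number \<gamma> z)"
      using pth by (intro continuous_intros continuous_on_subset[OF continuous_on_winding_number])
        (auto simp: GC_def)
    then show ?thesis by (rule continuous_on_eq) (simp add: hK)
  qed
  ultimately have cont: "continuous_on (C \<union> - K) h"
    using oC by (intro continuous_on_open_Un) (auto simp: K_def)
  have "C \<union> - K = UNIV" using KC by blast
  with cont have cont: "continuous_on UNIV h" by simp
  have int: "h z \<in> \<int>" for z
  proof (cases "z \<in> C")
    case True
    then show ?thesis
      using R' pth by (auto simp: h_def GR_def intro!: Ints_minus Ints_sum integer_winding_number)
  next
    case False
    then show ?thesis
      using pth by (auto simp: h_def GC_def intro!: Ints_sum integer_winding_number)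
  qed
  obtain c where c: "\<And>z. h z = c"
  proof -
    have "h constant_on UNIV"
    proof (rule continuous_discrete_range_constant[OF connected_UNIV cont])
      fix x
      have "1 \<le> norm (h y - h x)" if "h y \<noteq> h x" for y
      proof -
        have "h y - h x \<in> \<int>" using int by (intro Ints_diff)
        then obtain k where k: "h y - h x = of_int k" by (elim Ints_cases)
        with that have "k \<noteq> 0" by auto
        then show ?thesis unfolding k norm_of_int by linarith
      qed
      then show "\<exists>e>0. \<forall>y. y \<in> UNIV \<and> h y \<noteq> h x \<longrightarrow> e \<le> norm (h y - h x)"
        by (intro exI[of _ 1]) auto
    qed
    then show thesis using that by (auto simp: constant_on_def)
  qed
  obtain r where r: "closure D \<subseteq> cball 0 r"
    using bounded_closure[OF D(1)] by (auto simp: bounded_iff subset_iff)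
  define z where "z = complex_of_real (\<bar>r\<bar> + 1)"
  have zr: "z \<notin> cball 0 r"
  proof -
    have "norm z = \<bar>r\<bar> + 1" unfolding z_def norm_of_real by simp
    then show ?thesis by simp
  qed
  have "winding_number \<gamma> z = 0" if "\<gamma> \<in> \<Gamma>" for \<gamma>
    using pth[OF that] r zr
    by (intro winding_number_zero_outside[OF _ convex_cball]) auto
  then have "h z = 0" by (auto simp: h_def GR_def GC_def)
  with c have "h w = 0" by metis
  then show ?thesis using w by (simp add: h_def GC_def)
qed

lemma Cauchy_theorem_boundary:
  assumes \<Omega>: "open \<Omega>" and D: "bounded D" "closure D \<subseteq> \<Omega>"
    and bd: "positively_oriented_boundary D \<Gamma>" and f: "f holomorphic_on \<Omega>"
  shows "(\<Sum>\<gamma>\<in>\<Gamma>. contour_integral \<gamma> f) = 0"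
proof -
  have fin: "finite \<Gamma>" using bd by (auto simp: positively_oriented_boundary_def)
  have pth: "valid_path \<gamma>" "pathfinish \<gamma> = pathstart \<gamma>" "path_image \<gamma> \<subseteq> \<Omega>" if "\<gamma> \<in> \<Gamma>" for \<gamma>
    using bd that D by (auto simp: positively_oriented_boundary_def frontier_def)
  define comp where "comp \<gamma> = connected_component_set \<Omega> (pathstart \<gamma>)" for \<gamma>
  have st: "pathstart \<gamma> \<in> \<Omega>" if "\<gamma> \<in> \<Gamma>" for \<gamma>
    using pth(3)[OF that] by blast
  have compin: "comp \<gamma> \<in> components \<Omega>" if "\<gamma> \<in> \<Gamma>" for \<gamma>
    using st[OF that] by (auto simp: comp_def components_def)
  have eq: "{\<gamma>\<in>\<Gamma>. comp \<gamma> = C} = {\<gamma>\<in>\<Gamma>. path_image \<gamma> \<subseteq> C}" if C: "C \<in> components \<Omega>" for C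
  proof -
    have "path_image \<gamma> \<subseteq> comp \<gamma>" if "\<gamma> \<in> \<Gamma>" for \<gamma>
      unfolding comp_def using pth[OF that]
      by (intro connected_component_maximal)
        (auto intro: connected_path_image valid_path_imp_path)
    moreover have "comp \<gamma> = C" if g: "\<gamma> \<in> \<Gamma>" "path_image \<gamma> \<subseteq> C" for \<gamma>
    proof -
      have "pathstart \<gamma> \<in> C \<inter> comp \<gamma>" using g calculation[of \<gamma>] by blast
      then show ?thesis using components_nonoverlap[OF compin[OF g(1)] C] by blast
    qed
    ultimately show ?thesis by blast
  qed
  have "(\<Sum>\<gamma>\<in>\<Gamma>. contour_integral \<gamma> f) =
      (\<Sum>C\<in>comp ` \<Gamma>. \<Sum>\<gamma>\<in>{\<gamma>\<in>\<Gamma>. comp \<gamma> = C}. contour_integral \<gamma> f)"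
    using fin by (simp add: sum.group)
  also have "\<dots> = (\<Sum>C\<in>comp ` \<Gamma>. 0)"
  proof (rule sum.cong[OF refl])
    fix C assume "C \<in> comp ` \<Gamma>"
    then have C: "C \<in> components \<Omega>" using compin by blast
    show "(\<Sum>\<gamma>\<in>{\<gamma>\<in>\<Gamma>. comp \<gamma> = C}. contour_integral \<gamma> f) = 0"
      unfolding eq[OF C]
    proof (rule Cauchy_theorem_cycle_connected[of C])
      show "open C" by (rule open_components[OF \<Omega> C])
      show "connected C" by (rule in_components_connected[OF C])
      show "f holomorphic_on C"
        using f by (rule holomorphic_on_subset) (rule in_components_subset[OF C])
      show "(\<Sum>\<gamma>\<in>{\<gamma>\<in>\<Gamma>. path_image \<gamma> \<subseteq> C}. winding_number \<gamma> w) = 0" if "w \<notin> C" for w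
        by (rule winding_number_boundary_in_component[OF \<Omega> D bd C that])
    qed (use fin pth in auto)
  qed
  finally show ?thesis by simp
qed

text \<open>
  Subtracting the pole leaves the difference quotient, which extends holomorphically; the pole itself
  contributes the total winding number, which is \<open>1\<close> for a point of \<open>D\<close>.
\<close>

lemma Cauchy_integral_formula_boundary:
  assumes \<Omega>: "open \<Omega>" and D: "bounded D" "open D" "closure D \<subseteq> \<Omega>"
    and bd: "positively_oriented_boundary D \<Gamma>" and f: "f holomorphic_on \<Omega>" and p: "p \<in> D"
  shows "\<And>\<gamma>. \<gamma> \<in> \<Gamma> \<Longrightarrow> (\<lambda>w. f w / (w - p)) contour_integrable_on \<gamma>"
    and "(\<Sum>\<gamma>\<in>\<Gamma>. contour_integral \<gamma> (\<lambda>w. f w / (w - p))) = 2 * pi * \<i> * f p"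
proof -
  have pth: "valid_path \<gamma>" "pathfinish \<gamma> = pathstart \<gamma>" "path_image \<gamma> \<subseteq> \<Omega>" if "\<gamma> \<in> \<Gamma>" for \<gamma>
    using bd that D by (auto simp: positively_oriented_boundary_def frontier_def)
  have pf: "p \<notin> frontier D" using p D by (simp add: frontier_def interior_open)
  have pg: "p \<notin> path_image \<gamma>" if "\<gamma> \<in> \<Gamma>" for \<gamma>
    using bd that pf by (auto simp: positively_oriented_boundary_def)
  have int: "(\<lambda>w. g w / (w - p)) contour_integrable_on \<gamma>" if "\<gamma> \<in> \<Gamma>" "g holomorphic_on \<Omega>" for \<gamma> g
  proof (rule contour_integrable_holomorphic_simple[of _ "\<Omega> - {p}"])
    show "(\<lambda>w. g w / (w - p)) holomorphic_on \<Omega> - {p}"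
      by (intro holomorphic_intros holomorphic_on_subset[OF that(2)]) auto
  qed (use pth[OF that(1)] pg[OF that(1)] \<Omega> in auto)
  show "(\<lambda>w. f w / (w - p)) contour_integrable_on \<gamma>" if "\<gamma> \<in> \<Gamma>" for \<gamma>
    by (rule int[OF that f])
  define q where "q z = (if z = p then deriv f p else (f z - f p) / (z - p))" for z
  have q: "q holomorphic_on \<Omega>" unfolding q_def by (rule pole_lemma_open[OF f \<Omega>])
  have "contour_integral \<gamma> (\<lambda>w. f w / (w - p)) =
      contour_integral \<gamma> q + f p * (2 * pi * \<i> * winding_number \<gamma> p)" if g: "\<gamma> \<in> \<Gamma>" for \<gamma>
  proof -
    have qi: "q contour_integrable_on \<gamma>"
      by (rule contour_integrable_holomorphic_simple[OF q \<Omega>]) (use pth[OF g] in auto)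
    have oi: "(\<lambda>w. 1 / (w - p)) contour_integrable_on \<gamma>" by (rule int[OF g]) auto
    have "contour_integral \<gamma> (\<lambda>w. f w / (w - p)) = contour_integral \<gamma> (\<lambda>w. q w + f p * (1 / (w - p)))"
      using pg[OF g]
      by (intro contour_integral_cong) (auto simp: q_def diff_divide_distrib)
    also have "\<dots> = contour_integral \<gamma> q + f p * contour_integral \<gamma> (\<lambda>w. 1 / (w - p))"
      using qi oi by (simp only: contour_integral_add contour_integrable_lmul contour_integral_lmul)
    finally show ?thesis
      using winding_number_valid_path[OF pth(1)[OF g] pg[OF g]] by simp
  qed
  then have "(\<Sum>\<gamma>\<in>\<Gamma>. contour_integral \<gamma> (\<lambda>w. f w / (w - p))) =
      (\<Sum>\<gamma>\<in>\<Gamma>. contour_integral \<gamma> q) + f p * (2 * pi * \<i> * (\<Sum>\<gamma>\<in>\<Gamma>. winding_number \<gamma> p))"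
    by (simp add: sum.distrib sum_distrib_left)
  also have "(\<Sum>\<gamma>\<in>\<Gamma>. contour_integral \<gamma> q) = 0"
    by (rule Cauchy_theorem_boundary[OF \<Omega> D(1,3) bd q])
  also have "(\<Sum>\<gamma>\<in>\<Gamma>. winding_number \<gamma> p) = 1"
    using bd p pf by (auto simp: positively_oriented_boundary_def)
  finally show "(\<Sum>\<gamma>\<in>\<Gamma>. contour_integral \<gamma> (\<lambda>w. f w / (w - p))) = 2 * pi * \<i> * f p" by simp
qed

section \<open>Functions of class \<open>C\<^sup>k\<close> in the plane\<close>

lemma eventually_nhds_in_horizontal_line:
  assumes "open S" "z \<in> S"
  shows "\<forall>\<^sub>F t in nhds (Re z). Complex t (Im z) \<in> S"
proof -
  have "open ((\<lambda>t. Complex t (Im z)) -` S)"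
    by (intro open_vimage assms) (simp add: Complex_eq continuous_intros)
  then have "\<forall>\<^sub>F t in nhds (Re z). t \<in> (\<lambda>t. Complex t (Im z)) -` S"
    using assms by (intro eventually_nhds_in_open) auto
  then show ?thesis by simp
qed

lemma eventually_nhds_in_vertical_line:
  assumes "open S" "z \<in> S"
  shows "\<forall>\<^sub>F t in nhds (Im z). Complex (Re z) t \<in> S"
proof -
  have "open ((\<lambda>t. Complex (Re z) t) -` S)"
    by (intro open_vimage assms) (simp add: Complex_eq continuous_intros)
  then have "\<forall>\<^sub>F t in nhds (Im z). t \<in> (\<lambda>t. Complex (Re z) t) -` S"
    using assms by (intro eventually_nhds_in_open) auto
  then show ?thesis by simp
qed

definition has_partials :: "(complex \<Rightarrow> 'a::real_normed_vector) \<Rightarrow> 'a \<Rightarrow> 'a \<Rightarrow> complex \<Rightarrow> bool" where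
  "has_partials f a b z \<longleftrightarrow>
     ((\<lambda>t. f (Complex t (Im z))) has_vector_derivative a) (at (Re z)) \<and>
     ((\<lambda>t. f (Complex (Re z) t)) has_vector_derivative b) (at (Im z))"

lemma has_partials_imp_du_dv:
  "has_partials f a b z \<Longrightarrow> du f z = a" "has_partials f a b z \<Longrightarrow> dv f z = b"
  by (simp_all add: has_partials_def du_def dv_def vector_derivative_at)

lemma has_partials_iff:
  "has_partials f (du f z) (dv f z) z \<longleftrightarrow>
     (\<lambda>t. f (Complex t (Im z))) differentiable at (Re z) \<and>
     (\<lambda>t. f (Complex (Re z) t)) differentiable at (Im z)"
  by (simp add: has_partials_def du_def dv_def vector_derivative_works)

lemma class_C_Suc:
  "class_C (Suc k) S f \<longleftrightarrow> continuous_on S f \<and> (\<forall>z\<in>S. has_partials f (du f z) (dv f z) z) \<and>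
     class_C k S (du f) \<and> class_C k S (dv f)"
  by (simp only: class_C.simps has_partials_iff)

declare class_C.simps(2) [simp del]

lemma has_partials_cong:
  assumes "open S" "z \<in> S" "\<And>w. w \<in> S \<Longrightarrow> f w = g w" and f: "has_partials f a b z"
  shows "has_partials g a b z"
  unfolding has_partials_def
proof
  have "\<forall>\<^sub>F t in nhds (Re z). t \<in> UNIV \<longrightarrow> f (Complex t (Im z)) = g (Complex t (Im z))"
    using eventually_nhds_in_horizontal_line[OF assms(1,2)] by eventually_elim (use assms in simp)
  from has_vector_derivative_cong_ev[OF this]
  show "((\<lambda>t. g (Complex t (Im z))) has_vector_derivative a) (at (Re z))"
    using f assms(2,3) by (simp add: has_partials_def)
  have "\<forall>\<^sub>F t in nhds (Im z). t \<in> UNIV \<longrightarrow> f (Complex (Re z) t) = g (Complex (Re z) t)"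
    using eventually_nhds_in_vertical_line[OF assms(1,2)] by eventually_elim (use assms in simp)
  from has_vector_derivative_cong_ev[OF this]
  show "((\<lambda>t. g (Complex (Re z) t)) has_vector_derivative b) (at (Im z))"
    using f assms(2,3) by (simp add: has_partials_def)
qed

lemma du_dv_cong:
  assumes "open S" "z \<in> S" "\<And>w. w \<in> S \<Longrightarrow> f w = g w"
  shows "du f z = du g z" "dv f z = dv g z"
proof -
  have "\<forall>\<^sub>F t in nhds (Re z). t \<in> UNIV \<longrightarrow> f (Complex t (Im z)) = g (Complex t (Im z))"
    using eventually_nhds_in_horizontal_line[OF assms(1,2)] by eventually_elim (use assms in simp)
  then show "du f z = du g z"
    unfolding du_def by (rule vector_derivative_cong_eq) auto
  have "\<forall>\<^sub>F t in nhds (Im z). t \<in> UNIV \<longrightarrow> f (Complex (Re z) t) = g (Complex (Re z) t)"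
    using eventually_nhds_in_vertical_line[OF assms(1,2)] by eventually_elim (use assms in simp)
  then show "dv f z = dv g z"
    unfolding dv_def by (rule vector_derivative_cong_eq) auto
qed

lemma class_C_cong:
  assumes "open S" "\<And>w. w \<in> S \<Longrightarrow> f w = g w" "class_C k S f"
  shows "class_C k S g"
  using assms(2,3)
proof (induction k arbitrary: f g)
  case 0
  then show ?case by (simp cong: continuous_on_cong)
next
  case (Suc k)
  have eq: "du f z = du g z" "dv f z = dv g z" if "z \<in> S" for z
    using du_dv_cong[OF \<open>open S\<close> that Suc.prems(1)] by auto
  have "class_C k S (du g)"
    by (rule Suc.IH[of "du f"]) (use eq Suc.prems(2) in \<open>auto simp: class_C_Suc\<close>)
  moreover have "class_C k S (dv g)"
    by (rule Suc.IH[of "dv f"]) (use eq Suc.prems(2) in \<open>auto simp: class_C_Suc\<close>)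
  moreover have "continuous_on S g"
    using Suc.prems by (auto simp: class_C_Suc intro: continuous_on_eq)
  moreover have "has_partials g (du g z) (dv g z) z" if "z \<in> S" for z
    using has_partials_cong[OF \<open>open S\<close> that Suc.prems(1), where a = "du f z" and b = "dv f z"] that eq[OF that] Suc.prems(2)
    by (auto simp: class_C_Suc)
  ultimately show ?case unfolding class_C_Suc by blast
qed

lemma class_C_SucD: "class_C (Suc k) S f \<Longrightarrow> class_C k S f"
proof (induction k arbitrary: f)
  case (Suc k)
  then show ?case by (meson class_C_Suc)
qed (simp add: class_C_Suc)

lemma class_C_mono: "class_C m S f \<Longrightarrow> k \<le> m \<Longrightarrow> class_C k S f"
  by (induction m) (auto simp: le_Suc_eq dest: class_C_SucD)

lemma class_C_bounded_linear:
  assumes "open S" "bounded_linear L" "class_C k S f"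
  shows "class_C k S (\<lambda>z. L (f z))"
  using assms(3)
proof (induction k arbitrary: f)
  case 0
  then show ?case using assms(2) by (simp add: bounded_linear.continuous_on)
next
  case (Suc k)
  have p: "has_partials (\<lambda>z. L (f z)) (L (du f z)) (L (dv f z)) z" if "z \<in> S" for z
    using Suc.prems that bounded_linear.has_vector_derivative[OF assms(2)]
    by (auto simp: class_C_Suc has_partials_def)
  have "class_C k S (du (\<lambda>z. L (f z)))"
    by (rule class_C_cong[OF assms(1) _ Suc.IH[of "du f"]])
      (use has_partials_imp_du_dv[OF p] Suc.prems in \<open>auto simp: class_C_Suc\<close>)
  moreover have "class_C k S (dv (\<lambda>z. L (f z)))"
    by (rule class_C_cong[OF assms(1) _ Suc.IH[of "dv f"]])
      (use has_partials_imp_du_dv[OF p] Suc.prems in \<open>auto simp: class_C_Suc\<close>)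
  moreover have "continuous_on S (\<lambda>z. L (f z))"
    using Suc.prems assms(2) by (auto simp: class_C_Suc bounded_linear.continuous_on)
  ultimately show ?case
    unfolding class_C_Suc using p has_partials_imp_du_dv[OF p] by auto
qed

lemma class_C_add:
  assumes "open S" "class_C k S f" "class_C k S g"
  shows "class_C k S (\<lambda>z. f z + g z)"
  using assms(2,3)
proof (induction k arbitrary: f g)
  case 0
  then show ?case by (simp add: continuous_on_add)
next
  case (Suc k)
  have p: "has_partials (\<lambda>z. f z + g z) (du f z + du g z) (dv f z + dv g z) z" if "z \<in> S" for z
    using Suc.prems that
    by (auto simp: class_C_Suc has_partials_def intro!: has_vector_derivative_add)
  have "class_C k S (du (\<lambda>z. f z + g z))"
    by (rule class_C_cong[OF assms(1) _ Suc.IH[of "du f" "du g"]])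
      (use has_partials_imp_du_dv[OF p] Suc.prems in \<open>auto simp: class_C_Suc\<close>)
  moreover have "class_C k S (dv (\<lambda>z. f z + g z))"
    by (rule class_C_cong[OF assms(1) _ Suc.IH[of "dv f" "dv g"]])
      (use has_partials_imp_du_dv[OF p] Suc.prems in \<open>auto simp: class_C_Suc\<close>)
  moreover have "continuous_on S (\<lambda>z. f z + g z)"
    using Suc.prems by (auto simp: class_C_Suc intro: continuous_on_add)
  ultimately show ?case
    unfolding class_C_Suc using p has_partials_imp_du_dv[OF p] by auto
qed

text \<open>
  Class \<open>C\<^sup>1\<close> is given by partial derivatives only; the product rule and the passage to holomorphic
  functions below need the total derivative.
\<close>

lemma class_C_imp_has_derivative:
  assumes S: "open S" and f: "class_C (Suc k) S f" and z: "z \<in> S"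
  shows "(f has_derivative (\<lambda>h. Re h *\<^sub>R du f z + Im h *\<^sub>R dv f z)) (at z)"
proof -
  from S z obtain e where e: "e > 0" "ball z e \<subseteq> S" by (meson openE)
  define X where "X = {Re z - e/2 <..< Re z + e/2}"
  define Y where "Y = {Im z - e/2 <..< Im z + e/2}"
  have XY: "Complex x y \<in> S" if "x \<in> X" "y \<in> Y" for x y
  proof -
    have "norm (z - Complex x y) \<le> \<bar>Re z - x\<bar> + \<bar>Im z - y\<bar>"
      using cmod_le[of "z - Complex x y"] by simp
    also have "\<dots> < e" using that by (auto simp: X_def Y_def abs_less_iff)
    finally show ?thesis using e by (auto simp: dist_norm)
  qed
  have zXY: "Re z \<in> X" "Im z \<in> Y" using e by (auto simp: X_def Y_def)
  have P: "has_partials f (du f w) (dv f w) w" if "w \<in> S" for w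
    using f that by (auto simp: class_C_Suc)
  have "continuous_on S (dv f)" using f by (auto simp: class_C_Suc dest: class_C_mono[where k = 0])
  then have "continuous_on ((\<lambda>p. Complex (fst p) (snd p)) ` (X \<times> Y)) (dv f)"
    by (rule continuous_on_subset) (auto intro: XY)
  then have "continuous_on (X \<times> Y) (\<lambda>p. dv f (Complex (fst p) (snd p)))"
    by (rule continuous_on_compose2) (auto simp: Complex_eq intro!: continuous_intros)
  then have "continuous_on (X \<times> Y) (\<lambda>p. blinfun_scaleR_left (dv f (Complex (fst p) (snd p))))"
    by (intro continuous_intros)
  then have cont: "continuous (at (Re z, Im z) within X \<times> Y)
      (\<lambda>(x, y). blinfun_scaleR_left (dv f (Complex x y)))"
    using zXY by (simp add: continuous_on_eq_continuous_within case_prod_unfold)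
  have "((\<lambda>(x, y). f (Complex x y)) has_derivative
      (\<lambda>(tx, ty). tx *\<^sub>R du f z + blinfun_scaleR_left (dv f (Complex (Re z) (Im z))) ty))
      (at (Re z, Im z) within X \<times> Y)"
  proof (rule has_derivative_partialsI[OF _ _ cont])
    show "((\<lambda>x. f (Complex x (Im z))) has_derivative (\<lambda>tx. tx *\<^sub>R du f z)) (at (Re z) within X)"
      using P[OF z] by (auto simp: has_partials_def has_vector_derivative_def
          intro: has_derivative_at_withinI)
    show "((\<lambda>y. f (Complex x y)) has_derivative blinfun_scaleR_left (dv f (Complex x y))) (at y within Y)"
      if "x \<in> X" "y \<in> Y" for x y
      using P[OF XY[OF that]] by (auto simp: has_partials_def has_vector_derivative_def
          intro: has_derivative_at_withinI)
    show "Im z \<in> Y" "convex Y" using zXY by (auto simp: Y_def)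
  qed
  moreover have "at (Re z, Im z) within X \<times> Y = at (Re z, Im z)"
    using zXY by (intro at_within_open) (auto simp: X_def Y_def open_Times)
  ultimately have "((\<lambda>(x, y). f (Complex x y)) has_derivative
      (\<lambda>(tx, ty). tx *\<^sub>R du f z + ty *\<^sub>R dv f z)) (at (Re z, Im z))"
    by simp
  moreover have "((\<lambda>w. (Re w, Im w)) has_derivative (\<lambda>h. (Re h, Im h))) (at z)"
    by (intro has_derivative_Pair bounded_linear_imp_has_derivative bounded_linear_Re bounded_linear_Im)
  ultimately show ?thesis
    using has_derivative_compose[of "\<lambda>w. (Re w, Im w)" "\<lambda>h. (Re h, Im h)" z UNIV
        "\<lambda>(x, y). f (Complex x y)" "\<lambda>(tx, ty). tx *\<^sub>R du f z + ty *\<^sub>R dv f z"] by simp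
qed

section \<open>Polyanalytic functions with respect to a complex structure\<close>

text \<open>
  Left and right multiplication by an imaginary unit both square to \<open>- id\<close>. Working with an abstract
  such \<open>J\<close> covers the left and the right theory at once, and turns the noncommutative algebra
  into a complex vector space.
\<close>

locale complex_structure =
  fixes J :: "'a::euclidean_space \<Rightarrow> 'a"
  assumes bounded_linear_J: "bounded_linear J" and J_J [simp]: "J (J v) = - v"
begin

lemma J_linear:
  "J (v + w) = J v + J w" "J (r *\<^sub>R v) = r *\<^sub>R J v" "J (- v) = - J v" "J 0 = 0" "J (v - w) = J v - J w"
  using bounded_linear_J linear_simps[OF bounded_linear_J] by auto

definition act :: "complex \<Rightarrow> 'a \<Rightarrow> 'a" where
  "act c v = Re c *\<^sub>R v + Im c *\<^sub>R J v"

lemma act_mult: "act (c * d) v = act c (act d v)"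
  by (simp add: act_def J_linear algebra_simps)

lemma act_1 [simp]: "act 1 v = v"
  by (simp add: act_def)

lemma bounded_bilinear_act: "bounded_bilinear act"
  unfolding bilinear_conv_bounded_bilinear[symmetric] bilinear_def
  by (auto intro!: linearI simp: act_def J_linear algebra_simps)

sublocale act: bounded_bilinear act
  by (rule bounded_bilinear_act)

definition dbar :: "(complex \<Rightarrow> 'a) \<Rightarrow> complex \<Rightarrow> 'a" where
  "dbar f z = (1/2) *\<^sub>R (du f z + J (dv f z))"

lemma dbar_iterate_cong:
  assumes "open S" "\<And>w. w \<in> S \<Longrightarrow> f w = g w" "z \<in> S"
  shows "(dbar ^^ l) f z = (dbar ^^ l) g z"
  using assms(3)
proof (induction l arbitrary: z)
  case (Suc l)
  then have "du ((dbar ^^ l) f) z = du ((dbar ^^ l) g) z" "dv ((dbar ^^ l) f) z = dv ((dbar ^^ l) g) z"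
    using du_dv_cong[OF assms(1) Suc.prems, of "(dbar ^^ l) f" "(dbar ^^ l) g"] by simp_all
  then show ?case
    unfolding funpow.simps o_apply by (subst (1 2) dbar_def) simp
qed (use assms in simp)

lemma class_C_dbar:
  assumes "open S" "class_C (Suc k) S f"
  shows "class_C k S (dbar f)"
proof -
  have "bounded_linear (\<lambda>v. (1/2) *\<^sub>R J v)"
    by (rule bounded_linear_compose[OF bounded_linear_scaleR_right bounded_linear_J])
  then have "class_C k S (\<lambda>z. (1/2) *\<^sub>R du f z + (1/2) *\<^sub>R J (dv f z))"
    using assms by (intro class_C_add class_C_bounded_linear[of S "\<lambda>v. (1/2) *\<^sub>R v"]
        class_C_bounded_linear[of S "\<lambda>v. (1/2) *\<^sub>R J v"] bounded_linear_scaleR_right)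
      (auto simp: class_C_Suc)
  then show ?thesis by (simp add: dbar_def [abs_def] scaleR_add_right)
qed

lemma class_C_dbar_iterate:
  assumes "open S" "class_C (k + l) S f"
  shows "class_C k S ((dbar ^^ l) f)"
  using assms(2)
proof (induction l arbitrary: k)
  case (Suc l)
  then show ?case using class_C_dbar[OF assms(1), of k "(dbar ^^ l) f"] Suc.IH[of "Suc k"] by simp
qed simp

text \<open>
  The operator \<open>\<partial>\<^sub>u + J \<partial>\<^sub>v\<close>, whose powers define poly slice monogenic functions; the Cauchy integrals
  contain the powers of half of it.
\<close>

definition cr :: "(complex \<Rightarrow> 'a) \<Rightarrow> complex \<Rightarrow> 'a" where
  "cr f z = du f z + J (dv f z)"

lemma cr_iterate_eq_dbar_iterate:
  assumes S: "open S" and f: "class_C M S f" and "l \<le> M" "z \<in> S"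
  shows "(cr ^^ l) f z = 2 ^ l *\<^sub>R (dbar ^^ l) f z"
  using assms(3,4)
proof (induction l arbitrary: z)
  case (Suc l)
  define g where "g = (dbar ^^ l) f"
  have "class_C (Suc 0) S g"
    unfolding g_def using Suc.prems f by (intro class_C_dbar_iterate S) (auto intro: class_C_mono)
  then have "has_partials g (du g z) (dv g z) z"
    using Suc.prems by (simp add: class_C_Suc)
  then have "has_partials (\<lambda>z. 2 ^ l *\<^sub>R g z) (2 ^ l *\<^sub>R du g z) (2 ^ l *\<^sub>R dv g z) z"
    unfolding has_partials_def
    using bounded_linear.has_vector_derivative[OF bounded_linear_scaleR_right] by blast
  then have p: "has_partials ((cr ^^ l) f) (2 ^ l *\<^sub>R du g z) (2 ^ l *\<^sub>R dv g z) z"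
    by (rule has_partials_cong[OF S Suc.prems(2), rotated]) (use Suc in \<open>simp add: g_def\<close>)
  have "(cr ^^ Suc l) f z = 2 ^ l *\<^sub>R (du g z + J (dv g z))"
    using has_partials_imp_du_dv[OF p] by (simp add: cr_def J_linear scaleR_add_right)
  moreover have "(dbar ^^ Suc l) f z = dbar g z" by (simp add: g_def)
  ultimately show ?case by (simp add: dbar_def[of g z])
qed simp

text \<open>
  The Taylor polynomial of \<open>f\<close> in the conjugate variable, centred at \<open>z\<close> and evaluated at \<open>p\<close>. It is
  to be read as a function of the centre \<open>z\<close>.
\<close>

definition conj_taylor :: "nat \<Rightarrow> (complex \<Rightarrow> 'a) \<Rightarrow> complex \<Rightarrow> complex \<Rightarrow> 'a" where
  "conj_taylor M f p z = (\<Sum>l<M. act ((cnj p - cnj z) ^ l / fact l) ((dbar ^^ l) f z))"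

lemma has_derivative_conj_monomial:
  "((\<lambda>z. (cnj p - cnj z) ^ Suc m / fact (Suc m)) has_derivative
    (\<lambda>h. (cnj p - cnj z) ^ m / fact m * (- cnj h))) (at z)"
proof -
  have inner: "((\<lambda>z. cnj p - cnj z) has_derivative (\<lambda>h. - cnj h)) (at z)"
    by (auto intro!: derivative_eq_intros bounded_linear.has_derivative[OF bounded_linear_cnj])
  have "((\<lambda>w::complex. w ^ Suc m * inverse (fact (Suc m))) has_field_derivative
      (of_nat (Suc m) * (cnj p - cnj z) ^ m) * inverse (fact (Suc m))) (at (cnj p - cnj z))"
    by (intro DERIV_cmult_right) (use DERIV_power[OF DERIV_ident, of "Suc m"] in simp)
  also have "(of_nat (Suc m) * (cnj p - cnj z) ^ m) * inverse (fact (Suc m)) =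
      (cnj p - cnj z) ^ m / (fact m :: complex)"
    by (simp add: divide_inverse del: of_nat_Suc)
  finally have "((\<lambda>w::complex. w ^ Suc m / fact (Suc m)) has_field_derivative
      (cnj p - cnj z) ^ m / fact m) (at (cnj p - cnj z))"
    by (simp only: divide_inverse)
  from has_derivative_compose[OF inner this[unfolded has_field_derivative_def]]
  show ?thesis by simp
qed

text \<open>
  Moving the centre of a Taylor polynomial telescopes: each monomial differentiates to minus the
  preceding one, so the conjugate derivative of the sum is its last term alone.
\<close>

lemma conj_taylor_has_derivative:
  assumes S: "open S" "z \<in> S" and f: "class_C M S f" and m: "Suc m \<le> M"
  shows "\<exists>G. (conj_taylor (Suc m) f p has_derivative G) (at z) \<and>
     G 1 + J (G \<i>) = 2 *\<^sub>R act ((cnj p - cnj z) ^ m / fact m) ((dbar ^^ Suc m) f z)"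
  using m
proof (induction m)
  case 0
  have "class_C (Suc 0) S f" using f 0 by (auto intro: class_C_mono)
  from class_C_imp_has_derivative[OF S(1) this S(2)]
  show ?case
    by (intro exI[of _ "\<lambda>h. Re h *\<^sub>R du f z + Im h *\<^sub>R dv f z"])
      (simp add: conj_taylor_def [abs_def] dbar_def)
next
  case (Suc m)
  define D where "D = (dbar ^^ Suc m) f"
  define c where "c l z = (cnj p - cnj z) ^ l / fact l" for l z
  from Suc obtain G where G: "(conj_taylor (Suc m) f p has_derivative G) (at z)"
    "G 1 + J (G \<i>) = 2 *\<^sub>R act (c m z) (D z)"
    by (auto simp: D_def c_def)
  have "class_C (Suc 0) S D"
    unfolding D_def using Suc.prems f by (intro class_C_dbar_iterate S) (auto intro: class_C_mono)
  from class_C_imp_has_derivative[OF S(1) this S(2)]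
  have D: "(D has_derivative (\<lambda>h. Re h *\<^sub>R du D z + Im h *\<^sub>R dv D z)) (at z)" .
  define T where "T h = act (c (Suc m) z) (Re h *\<^sub>R du D z + Im h *\<^sub>R dv D z) +
      act (c m z * (- cnj h)) (D z)" for h
  have T: "((\<lambda>z. act (c (Suc m) z) (D z)) has_derivative T) (at z)"
    unfolding T_def c_def by (rule act.FDERIV[OF has_derivative_conj_monomial D])
  have split: "conj_taylor (Suc (Suc m)) f p = (\<lambda>z. conj_taylor (Suc m) f p z + act (c (Suc m) z) (D z))"
    by (simp add: conj_taylor_def fun_eq_iff c_def D_def)
  have "T 1 + J (T \<i>) = 2 *\<^sub>R act (c (Suc m) z) (dbar D z) - 2 *\<^sub>R act (c m z) (D z)"
    unfolding T_def dbar_def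
    by (simp add: act_def J_linear algebra_simps flip: scaleR_2)
  moreover have "(G 1 + T 1) + J (G \<i> + T \<i>) = (G 1 + J (G \<i>)) + (T 1 + J (T \<i>))"
    by (simp add: J_linear)
  ultimately have "(G 1 + T 1) + J (G \<i> + T \<i>) = 2 *\<^sub>R act (c (Suc m) z) (dbar D z)"
    using G(2) by simp
  moreover have "(conj_taylor (Suc (Suc m)) f p has_derivative (\<lambda>h. G h + T h)) (at z)"
    unfolding split by (rule has_derivative_add[OF G(1) T])
  ultimately show ?case
    by (intro exI[of _ "\<lambda>h. G h + T h"]) (simp add: c_def D_def)
qed

text \<open>
  The functional \<open>\<lambda>v. inner v b\<close> is only real linear; it is the real part of exactly one
  functional that is complex linear with respect to \<open>J\<close>, namely this one.
\<close>

definition complexified :: "'a \<Rightarrow> 'a \<Rightarrow> complex" where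
  "complexified b v = Complex (inner v b) (- inner (J v) b)"

lemma complexified_act: "complexified b (act c v) = c * complexified b v"
  by (simp add: complexified_def act_def complex_eq_iff J_linear inner_add_left inner_diff_left)

lemma Re_complexified [simp]: "Re (complexified b v) = inner v b"
  by (simp add: complexified_def)

lemma bounded_linear_complexified: "bounded_linear (complexified b)"
  unfolding linear_conv_bounded_linear[symmetric]
  by (rule linearI) (simp_all add: complexified_def complex_eq_iff J_linear inner_add_left)

lemma holomorphic_on_complexified:
  assumes "\<And>z. z \<in> S \<Longrightarrow> \<exists>G. (g has_derivative G) (at z) \<and> G 1 + J (G \<i>) = 0"
  shows "(\<lambda>z. complexified b (g z)) holomorphic_on S"
  unfolding holomorphic_on_def
proof
  fix z assume "z \<in> S"
  with assms obtain G where G: "(g has_derivative G) (at z)" "G 1 + J (G \<i>) = 0" by blast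
  have "J (G 1) = G \<i>"
    using arg_cong[OF G(2), of J] by (simp add: J_linear)
  have G1: "G h = act h (G 1)" for h
  proof -
    have "linear G" using has_derivative_bounded_linear[OF G(1)] by (rule bounded_linear.linear)
    then have "G (Re h *\<^sub>R 1 + Im h *\<^sub>R \<i>) = Re h *\<^sub>R G 1 + Im h *\<^sub>R G \<i>"
      by (simp only: linear_add linear_scale)
    moreover have "Re h *\<^sub>R 1 + Im h *\<^sub>R \<i> = h" by (simp add: complex_eq_iff)
    ultimately show ?thesis by (simp add: act_def \<open>J (G 1) = G \<i>\<close>)
  qed
  have "complexified b (G h) = complexified b (G 1) * h" for h
    by (subst G1) (simp only: complexified_act mult.commute)
  then have eq: "(\<lambda>h. complexified b (G h)) = (*) (complexified b (G 1))"
    by (rule ext)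
  have "((\<lambda>z. complexified b (g z)) has_derivative (\<lambda>h. complexified b (G h))) (at z)"
    by (rule bounded_linear.has_derivative[OF bounded_linear_complexified G(1)])
  then have "((\<lambda>z. complexified b (g z)) has_field_derivative complexified b (G 1)) (at z)"
    unfolding eq has_field_derivative_def .
  then show "(\<lambda>z. complexified b (g z)) field_differentiable at z within S"
    using field_differentiable_at_within field_differentiable_def by blast
qed

text \<open>
  The integrand is the ordinary Cauchy kernel applied to \<open>z \<mapsto> conj_taylor M f p z\<close>. Since the \<open>M\<close>-th
  conjugate derivative of \<open>f\<close> vanishes, that function is holomorphic, so the classical formula
  returns its value at \<open>p\<close>, where only the constant term \<open>f p\<close> of the Taylor polynomial survives.
\<close>

proposition polyanalytic_Cauchy_formula:
  assumes \<Omega>: "open \<Omega>" and D: "bounded D" "open D" "closure D \<subseteq> \<Omega>"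
    and bd: "positively_oriented_boundary D \<Gamma>"
    and M: "M \<ge> 1" and f: "class_C M \<Omega> f" and f0: "\<And>z. z \<in> \<Omega> \<Longrightarrow> (dbar ^^ M) f z = 0"
    and p: "p \<in> D"
  defines "\<omega> \<equiv> \<lambda>z w. \<Sum>l<M. act ((cnj p - cnj z) ^ l / (fact l * (z - p)) * (- \<i> * w)) ((dbar ^^ l) f z)"
  shows "form_integrable_on_curves \<Gamma> \<omega>" "form_integral_on_curves \<Gamma> \<omega> = (2 * pi) *\<^sub>R f p"
proof -
  define G where "G = conj_taylor M f p"
  obtain m where m: "M = Suc m" using M by (cases M) auto
  have \<omega>: "\<omega> z w = act (- \<i> * w / (z - p)) (G z)" for z w
    unfolding \<omega>_def G_def conj_taylor_def act.sum_right act_mult[symmetric]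
    by (intro sum.cong refl arg_cong2[where f = act]) (simp add: mult_ac)
  have "\<exists>G'. (G has_derivative G') (at z) \<and> G' 1 + J (G' \<i>) = 0" if "z \<in> \<Omega>" for z
    using conj_taylor_has_derivative[OF \<Omega> that f, of m p] f0[OF that] m by (simp add: G_def act.zero_right)
  from holomorphic_on_complexified[OF this]
  have hol: "(\<lambda>z. complexified b (G z)) holomorphic_on \<Omega>" for b .
  have comp: "((\<lambda>t. inner (\<omega> (\<gamma> t) (vector_derivative \<gamma> (at t within {0..1}))) b) has_integral
      Re (- \<i> * contour_integral \<gamma> (\<lambda>w. complexified b (G w) / (w - p)))) {0..1}"
    if "\<gamma> \<in> \<Gamma>" for \<gamma> b
  proof -
    have "((\<lambda>w. complexified b (G w) / (w - p)) has_contour_integral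
        contour_integral \<gamma> (\<lambda>w. complexified b (G w) / (w - p))) \<gamma>"
      by (rule has_contour_integral_integral
          [OF Cauchy_integral_formula_boundary(1)[OF \<Omega> D bd hol p that]])
    from has_contour_integral_lmul[OF this, of "- \<i>", unfolded has_contour_integral_def]
    have "((\<lambda>t. Re (- \<i> * (complexified b (G (\<gamma> t)) / (\<gamma> t - p)) *
        vector_derivative \<gamma> (at t within {0..1}))) has_integral
      Re (- \<i> * contour_integral \<gamma> (\<lambda>w. complexified b (G w) / (w - p)))) {0..1}"
      by (rule has_integral_linear[OF _ bounded_linear_Re, unfolded o_def])
    moreover have "inner (\<omega> z w) b = Re (- \<i> * (complexified b (G z) / (z - p)) * w)" for z w
    proof -
      have "inner (\<omega> z w) b = Re (complexified b (\<omega> z w))" by simp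
      also have "complexified b (\<omega> z w) = - \<i> * (complexified b (G z) / (z - p)) * w"
        unfolding \<omega> complexified_act by simp
      finally show ?thesis .
    qed
    ultimately show ?thesis by simp
  qed
  have int: "(\<lambda>t. \<omega> (\<gamma> t) (vector_derivative \<gamma> (at t within {0..1}))) integrable_on {0..1}"
    if "\<gamma> \<in> \<Gamma>" for \<gamma>
    by (rule integrable_componentwise) (use comp[OF that] in blast)
  then show "form_integrable_on_curves \<Gamma> \<omega>"
    by (simp add: form_integrable_on_curves_def)
  have Gp: "G p = f p"
    by (simp add: G_def m conj_taylor_def sum.lessThan_Suc_shift act.zero_left del: sum.lessThan_Suc)
  show "form_integral_on_curves \<Gamma> \<omega> = (2 * pi) *\<^sub>R f p"
  proof (rule euclidean_eqI)
    fix b :: 'a assume "b \<in> Basis"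
    \<comment> \<open>Complex linearity of \<open>complexified b\<close> makes every component the real part of an ordinary
      contour integral.\<close>
    have "inner (form_integral_on_curves \<Gamma> \<omega>) b = (\<Sum>\<gamma>\<in>\<Gamma>.
        integral {0..1} (\<lambda>t. inner (\<omega> (\<gamma> t) (vector_derivative \<gamma> (at t within {0..1}))) b))"
      unfolding form_integral_on_curves_def inner_sum_left
      using integral_linear[OF int bounded_linear_inner_left, of _ b]
      by (intro sum.cong refl) (simp add: o_def)
    also have "\<dots> = (\<Sum>\<gamma>\<in>\<Gamma>. Re (- \<i> * contour_integral \<gamma> (\<lambda>w. complexified b (G w) / (w - p))))"
      by (intro sum.cong refl integral_unique comp)
    also have "\<dots> = Re (- \<i> * (\<Sum>\<gamma>\<in>\<Gamma>. contour_integral \<gamma> (\<lambda>w. complexified b (G w) / (w - p))))"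
      by (simp only: sum_distrib_left Re_sum)
    also have "\<dots> = 2 * pi * inner (G p) b"
      unfolding Cauchy_integral_formula_boundary(2)[OF \<Omega> D bd hol p] by simp
    finally show "inner (form_integral_on_curves \<Gamma> \<omega>) b = inner ((2 * pi) *\<^sub>R f p) b"
      by (simp add: Gp)
  qed
qed

end

section \<open>The kernels in the planes \<open>\<complex>\<^sub>j\<close>\<close>

text \<open>
  Averaging the double sum with its transpose replaces \<open>e\<^sub>i e\<^sub>k\<close> by half of the anticommutator, which
  is nonzero only on the diagonal.
\<close>

lemma imag_unit_square:
  assumes "j \<in> imag_units"
  shows "imag_unit j * imag_unit j = -1"
proof -
  define e where "e = (generator :: 'a \<Rightarrow> 'a clifford)"
  have I: "imag_unit j = (\<Sum>i\<in>UNIV. (j $ i) *\<^sub>R e i)"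
    by (simp add: imag_unit_def paravector_def e_def)
  have J: "imag_unit j * imag_unit j = (\<Sum>i\<in>UNIV. \<Sum>k\<in>UNIV. (j $ i * j $ k) *\<^sub>R (e i * e k))"
    unfolding I by (simp add: sum_product mult.commute)
  also have "\<dots> = (\<Sum>i\<in>UNIV. \<Sum>k\<in>UNIV. (j $ i * j $ k) *\<^sub>R (e k * e i))"
    by (subst sum.swap) (simp add: mult.commute)
  finally have J': "imag_unit j * imag_unit j = (\<Sum>i\<in>UNIV. \<Sum>k\<in>UNIV. (j $ i * j $ k) *\<^sub>R (e k * e i))" .
  have "imag_unit j * imag_unit j + imag_unit j * imag_unit j =
      (\<Sum>i\<in>UNIV. \<Sum>k\<in>UNIV. (j $ i * j $ k) *\<^sub>R (e i * e k + e k * e i))"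
    by (subst J, subst J') (simp add: sum.distrib scaleR_add_right)
  also have "\<dots> = (\<Sum>i\<in>UNIV. \<Sum>k\<in>UNIV. if k = i then (- 2 * (j $ i)\<^sup>2) *\<^sub>R 1 else 0)"
    using generator_anticommute[where 'a = 'a] generator_square[where 'a = 'a]
    by (intro sum.cong refl) (auto simp: e_def power2_eq_square simp flip: scaleR_2)
  also have "\<dots> = (- 2 * (\<Sum>i\<in>UNIV. (j $ i)\<^sup>2)) *\<^sub>R 1"
    by (simp add: scaleR_sum_left sum_distrib_left)
  also have "(\<Sum>i\<in>UNIV. (j $ i)\<^sup>2) = 1"
    using assms by (simp add: norm_vec_def L2_set_def)
  finally have "2 *\<^sub>R (imag_unit j * imag_unit j) = 2 *\<^sub>R (- 1)"
    by (simp add: scaleR_2)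
  then show ?thesis by (simp only: scaleR_cancel_left) simp
qed

text \<open>
  For an imaginary unit \<open>j\<close> this is the isomorphism of algebras from \<open>\<complex>\<close> onto \<open>\<complex>\<^sub>j\<close>.
\<close>

definition slice_number :: "real ^ 'n::{finite,linorder} \<Rightarrow> complex \<Rightarrow> 'n clifford" where
  "slice_number j c = paravector (slice_point j c)"

lemma slice_number_eq: "slice_number j c = Re c *\<^sub>R 1 + Im c *\<^sub>R imag_unit j"
  by (simp add: slice_number_def paravector_def slice_point_def imag_unit_def scaleR_sum_right of_real_def)

lemma paravector_conj_slice_point: "paravector (conj_point (slice_point j c)) = slice_number j (cnj c)"
  by (simp add: slice_number_def conj_point_def slice_point_def)

lemma slice_number_simps [simp]:
  "slice_number j 0 = 0" "slice_number j 1 = 1" "slice_number j (c + d) = slice_number j c + slice_number j d"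
  "slice_number j (c - d) = slice_number j c - slice_number j d" "slice_number j (- c) = - slice_number j c"
  "slice_number j (r *\<^sub>R c) = r *\<^sub>R slice_number j c"
  by (simp_all add: slice_number_eq algebra_simps)

lemma slice_number_sum: "slice_number j (sum f A) = (\<Sum>a\<in>A. slice_number j (f a))"
  by (induction A rule: infinite_finite_induct) auto

lemma slice_number_mult:
  assumes "j \<in> imag_units"
  shows "slice_number j (c * d) = slice_number j c * slice_number j d"
  using imag_unit_square[OF assms] by (simp add: slice_number_eq algebra_simps)

lemma slice_number_power:
  assumes "j \<in> imag_units"
  shows "slice_number j (c ^ k) = slice_number j c ^ k"
  by (induction k) (simp_all add: slice_number_mult[OF assms])

text \<open>
  The representation formula of slice analysis for the identity: an element of \<open>\<complex>\<^sub>i\<close> is recovered, by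
  constant factors independent of it, from the two corresponding conjugate elements of \<open>\<complex>\<^sub>j\<close>. As
  \<^const>\<open>slice_number\<close> is multiplicative, it carries over to every function with real coefficients of a
  paravector.
\<close>

lemma slice_number_via_left:
  assumes j: "j \<in> imag_units"
  shows "slice_number i c = (1/2) *\<^sub>R (1 - imag_unit i * imag_unit j) * slice_number j c +
    (1/2) *\<^sub>R (1 + imag_unit i * imag_unit j) * slice_number j (cnj c)"
proof -
  have "imag_unit i * imag_unit j * imag_unit j = - imag_unit i"
    using imag_unit_square[OF j] by (simp add: mult.assoc)
  then show ?thesis by (simp add: slice_number_eq algebra_simps flip: scaleR_add_left)
qed

lemma slice_number_via_right:
  assumes j: "j \<in> imag_units"
  shows "slice_number i c = slice_number j c * ((1/2) *\<^sub>R (1 - imag_unit j * imag_unit i)) +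
    slice_number j (cnj c) * ((1/2) *\<^sub>R (1 + imag_unit j * imag_unit i))"
proof -
  have "imag_unit j * (imag_unit j * imag_unit i) = - imag_unit i"
    using imag_unit_square[OF j] by (simp flip: mult.assoc)
  then show ?thesis by (simp add: slice_number_eq algebra_simps flip: scaleR_add_left)
qed

lemma clifford_inverse_slice_number:
  assumes i: "i \<in> imag_units" and "q \<noteq> 0"
  shows "clifford_inverse (slice_number i q) = slice_number i (1 / q)"
proof -
  have r: "slice_number i q * slice_number i (1 / q) = 1" and l: "slice_number i (1 / q) * slice_number i q = 1"
    using \<open>q \<noteq> 0\<close> by (simp_all flip: slice_number_mult[OF i])
  show ?thesis
    unfolding clifford_inverse_def
  proof (rule the_equality)
    fix b assume "slice_number i q * b = 1 \<and> b * slice_number i q = 1"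
    then show "b = slice_number i (1 / q)"
      using r by (metis mult.assoc mult_1_left mult_1_right)
  qed (use l r in blast)
qed

lemma norm_slice_point:
  assumes "j \<in> imag_units"
  shows "norm (slice_point j z) = norm z"
  using assms by (simp add: slice_point_def norm_Pair cmod_def)

text \<open>
  The denominator has real coefficients as a polynomial in \<open>x\<close>, so it can be factored in the plane
  of \<open>x\<close>, whatever the plane of \<open>s\<close> is.
\<close>

lemma kernel_denominator_slice_points:
  assumes j: "j \<in> imag_units" and i: "i \<in> imag_units"
  shows "kernel_denominator (slice_point j z) (slice_point i w) = slice_number i ((w - z) * (w - cnj z))"
proof -
  have "(w - z) * (w - cnj z) = w ^ 2 - (2 * Re z) *\<^sub>R w + ((norm z)\<^sup>2) *\<^sub>R 1"
    unfolding cmod_power2 by (simp add: complex_eq_iff power2_eq_square algebra_simps)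
  moreover have "fst (slice_point j z) = Re z" by (simp add: slice_point_def)
  ultimately show ?thesis
    by (simp add: kernel_denominator_def norm_slice_point[OF j] slice_number_power[OF i] of_real_def
        flip: slice_number_def)
qed

text \<open>
  Both kernels reduce to this function when \<open>s\<close> and \<open>x\<close> lie in the same plane \<open>\<complex>\<^sub>j\<close>.
\<close>

definition poly_kernel :: "nat \<Rightarrow> complex \<Rightarrow> complex \<Rightarrow> complex" where
  "poly_kernel l z p = (cnj p - cnj z) ^ l / (fact l * (z - p))"

lemma poly_kernel_expansion:
  "poly_kernel l z p =
    (1 / fact l) *\<^sub>R (\<Sum>k\<le>l. real (l choose k) *\<^sub>R (cnj p ^ k * (1 / (z - p)) * (- cnj z) ^ (l - k)))"
proof -
  have "(cnj p - cnj z) ^ l = (\<Sum>k\<le>l. of_nat (l choose k) * cnj p ^ k * (- cnj z) ^ (l - k))"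
    using binomial_ring[of "cnj p" "- cnj z" l] by simp
  then show ?thesis
    by (simp add: poly_kernel_def scaleR_conv_of_real sum_divide_distrib sum_distrib_left field_simps)
qed

text \<open>
  In a common plane, one linear factor of the denominator cancels against \<open>x - cnj s\<close>, and what is left
  of \<open>S\<inverse>(s, x)\<close> is the Cauchy kernel.
\<close>

lemma kernel_fraction:
  assumes "w \<noteq> z" "w \<noteq> cnj z"
  shows "- (a * (1 / ((w - z) * (w - cnj z))) * (w - cnj z) * b) = a * (1 / (z - w)) * b"
proof -
  have "1 / ((w - z) * (w - cnj z)) * (w - cnj z) = 1 / (w - z)" using assms by simp
  also have "\<dots> = - (1 / (z - w))" by (simp add: minus_divide_right)
  finally have eq: "1 / ((w - z) * (w - cnj z)) * (w - cnj z) = - (1 / (z - w))" .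
  show ?thesis unfolding mult.assoc[of a] eq by simp
qed

text \<open>
  In the expanded kernel, the factors depending on \<open>x\<close> have real coefficients and stand to the left
  of all factors from \<open>\<complex>\<^sub>j\<close>. The representation formula therefore moves \<open>x\<close> to the plane of \<open>s\<close>, where
  everything commutes and the binomial theorem applies.
\<close>

lemma Pi_SL_slice_points:
  assumes j: "j \<in> imag_units" and i: "i \<in> imag_units" and ne: "w \<noteq> z" "w \<noteq> cnj z"
  shows "Pi_SL l (slice_point j z) (slice_point i w) =
    (1/2) *\<^sub>R (1 - imag_unit i * imag_unit j) * slice_number j (poly_kernel l z w) +
    (1/2) *\<^sub>R (1 + imag_unit i * imag_unit j) * slice_number j (poly_kernel l z (cnj w))"
    (is "_ = ?\<alpha> * _ + ?\<beta> * _")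
proof -
  define q where "q = (w - z) * (w - cnj z)"
  have q: "q \<noteq> 0" "cnj q = (cnj w - z) * (cnj w - cnj z)" using ne by (auto simp: q_def)
  have ne': "cnj w \<noteq> z" "cnj w \<noteq> cnj z" using ne by (auto simp: complex_eq_iff)
  define T where "T u k = cnj u ^ k * (1 / (z - u)) * (- cnj z) ^ (l - k)" for u k
  have "paravector (conj_point (slice_point i w)) ^ k * SL_inv (slice_point j z) (slice_point i w) *
      (- paravector (conj_point (slice_point j z))) ^ (l - k) =
      ?\<alpha> * slice_number j (T w k) + ?\<beta> * slice_number j (T (cnj w) k)" for k
  proof -
    \<comment> \<open>The coefficients that live in \<open>\<complex>\<^sub>i\<close> are collected in \<open>a\<close>, those in \<open>\<complex>\<^sub>j\<close> in \<open>b\<close>.\<close>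
    define a where "a = cnj w ^ k * (1 / q)"
    define b where "b = (- cnj z) ^ (l - k)"
    have "paravector (conj_point (slice_point i w)) ^ k * SL_inv (slice_point j z) (slice_point i w) *
        (- paravector (conj_point (slice_point j z))) ^ (l - k) =
        - (slice_number i (cnj w) ^ k * (slice_number i (1 / q) * (slice_number i w - slice_number j (cnj z))) * (- slice_number j (cnj z)) ^ (l - k))"
      unfolding SL_inv_def kernel_denominator_slice_points[OF j i] q_def[symmetric]
        clifford_inverse_slice_number[OF i q(1)] paravector_conj_slice_point slice_number_def[symmetric]
      by simp
    also have "\<dots> = - ((slice_number i (a * w) - slice_number i a * slice_number j (cnj z)) * slice_number j b)"
      unfolding a_def b_def slice_number_mult[OF i] slice_number_power[OF i] slice_number_power[OF j] slice_number_simps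
      by (simp add: algebra_simps)
    also have "\<dots> = - ((?\<alpha> * slice_number j (a * w) + ?\<beta> * slice_number j (cnj (a * w)) -
        (?\<alpha> * slice_number j a + ?\<beta> * slice_number j (cnj a)) * slice_number j (cnj z)) * slice_number j b)"
      by (simp only: slice_number_via_left[OF j, of i])
    also have "\<dots> = ?\<alpha> * slice_number j (- (a * (w - cnj z) * b)) +
        ?\<beta> * slice_number j (- (cnj a * (cnj w - cnj z) * b))"
      unfolding slice_number_mult[OF j] slice_number_simps complex_cnj_mult
      by (simp only: distrib_left distrib_right left_diff_distrib right_diff_distrib mult.assoc
          minus_add_distrib minus_diff_eq mult_minus_right) simp
    also have "- (a * (w - cnj z) * b) = T w k"
      unfolding a_def b_def T_def q_def by (rule kernel_fraction[OF ne])
    also have "- (cnj a * (cnj w - cnj z) * b) = T (cnj w) k"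
      using kernel_fraction[OF ne', of "w ^ k" b] q(2) by (simp add: a_def b_def T_def)
    finally show ?thesis .
  qed
  then have "Pi_SL l (slice_point j z) (slice_point i w) =
      (1 / fact l) *\<^sub>R (\<Sum>k\<le>l. real (l choose k) *\<^sub>R (?\<alpha> * slice_number j (T w k) + ?\<beta> * slice_number j (T (cnj w) k)))"
    by (simp only: Pi_SL_def)
  also have "\<dots> = ?\<alpha> * slice_number j (poly_kernel l z w) + ?\<beta> * slice_number j (poly_kernel l z (cnj w))"
    unfolding poly_kernel_expansion T_def[symmetric] slice_number_simps slice_number_sum
    by (simp only: scaleR_add_right sum.distrib mult_scaleR_right[symmetric] sum_distrib_left[symmetric])
  finally show ?thesis .
qed

text \<open>
  Here the factors depending on \<open>x\<close> stand to the right of all factors from \<open>\<complex>\<^sub>j\<close>, which calls for the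
  representation formula with constant factors on the right.
\<close>

lemma Pi_SR_slice_points:
  assumes j: "j \<in> imag_units" and i: "i \<in> imag_units" and ne: "w \<noteq> z" "w \<noteq> cnj z"
  shows "Pi_SR l (slice_point j z) (slice_point i w) =
    slice_number j (poly_kernel l z w) * ((1/2) *\<^sub>R (1 - imag_unit j * imag_unit i)) +
    slice_number j (poly_kernel l z (cnj w)) * ((1/2) *\<^sub>R (1 + imag_unit j * imag_unit i))"
    (is "_ = _ * ?\<alpha> + _ * ?\<beta>")
proof -
  define q where "q = (w - z) * (w - cnj z)"
  have q: "q \<noteq> 0" "cnj q = (cnj w - z) * (cnj w - cnj z)" using ne by (auto simp: q_def)
  have ne': "cnj w \<noteq> z" "cnj w \<noteq> cnj z" using ne by (auto simp: complex_eq_iff)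
  define T where "T u k = cnj u ^ k * (1 / (z - u)) * (- cnj z) ^ (l - k)" for u k
  have "(- paravector (conj_point (slice_point j z))) ^ (l - k) *
      SR_inv (slice_point j z) (slice_point i w) * paravector (conj_point (slice_point i w)) ^ k =
      slice_number j (T w k) * ?\<alpha> + slice_number j (T (cnj w) k) * ?\<beta>" for k
  proof -
    \<comment> \<open>The coefficients that live in \<open>\<complex>\<^sub>i\<close> are collected in \<open>a\<close>, those in \<open>\<complex>\<^sub>j\<close> in \<open>b\<close>.\<close>
    define a where "a = cnj w ^ k * (1 / q)"
    define b where "b = (- cnj z) ^ (l - k)"
    have "(- paravector (conj_point (slice_point j z))) ^ (l - k) *
        SR_inv (slice_point j z) (slice_point i w) * paravector (conj_point (slice_point i w)) ^ k =
        - ((- slice_number j (cnj z)) ^ (l - k) * ((slice_number i w - slice_number j (cnj z)) * slice_number i (1 / q)) * slice_number i (cnj w) ^ k)"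
      unfolding SR_inv_def kernel_denominator_slice_points[OF j i] q_def[symmetric]
        clifford_inverse_slice_number[OF i q(1)] paravector_conj_slice_point slice_number_def[symmetric]
      by simp
    also have "\<dots> = - (slice_number j b * (slice_number i (w * (1 / q * cnj w ^ k)) - slice_number j (cnj z) * slice_number i (1 / q * cnj w ^ k)))"
      unfolding b_def slice_number_mult[OF i] slice_number_power[OF i] slice_number_power[OF j] slice_number_simps
      by (simp add: algebra_simps)
    also have "\<dots> = - (slice_number j b * (slice_number i (a * w) - slice_number j (cnj z) * slice_number i a))"
      by (simp only: a_def mult_ac)
    also have "\<dots> = - (slice_number j b * (slice_number j (a * w) * ?\<alpha> + slice_number j (cnj (a * w)) * ?\<beta> -
        slice_number j (cnj z) * (slice_number j a * ?\<alpha> + slice_number j (cnj a) * ?\<beta>)))"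
      by (simp only: slice_number_via_right[OF j, of i])
    also have "\<dots> = slice_number j (- (b * (a * w - cnj z * a))) * ?\<alpha> +
        slice_number j (- (b * (cnj a * cnj w - cnj z * cnj a))) * ?\<beta>"
      unfolding slice_number_mult[OF j] slice_number_simps complex_cnj_mult
      by (simp only: distrib_left distrib_right left_diff_distrib right_diff_distrib mult.assoc
          minus_add_distrib minus_diff_eq mult_minus_left) simp
    also have "- (b * (a * w - cnj z * a)) = - (a * (w - cnj z) * b)"
      by (simp add: algebra_simps)
    also have "\<dots> = T w k"
      unfolding a_def b_def T_def q_def by (rule kernel_fraction[OF ne])
    also have "- (b * (cnj a * cnj w - cnj z * cnj a)) = - (cnj a * (cnj w - cnj z) * b)"
      by (simp add: algebra_simps)
    also have "\<dots> = T (cnj w) k"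
      using kernel_fraction[OF ne', of "w ^ k" b] q(2) by (simp add: a_def b_def T_def)
    finally show ?thesis .
  qed
  then have "Pi_SR l (slice_point j z) (slice_point i w) =
      (1 / fact l) *\<^sub>R (\<Sum>k\<le>l. real (l choose k) *\<^sub>R (slice_number j (T w k) * ?\<alpha> + slice_number j (T (cnj w) k) * ?\<beta>))"
    by (simp only: Pi_SR_def)
  also have "\<dots> = slice_number j (poly_kernel l z w) * ?\<alpha> + slice_number j (poly_kernel l z (cnj w)) * ?\<beta>"
    unfolding poly_kernel_expansion T_def[symmetric] slice_number_simps slice_number_sum
    by (simp only: scaleR_add_right sum.distrib mult_scaleR_left[symmetric] sum_distrib_right[symmetric])
  finally show ?thesis .
qed

section \<open>Slices of axially symmetric sets\<close>

lemma slice_point_mem_all_units: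
  assumes U: "axially_symmetric U" "slice_point i w \<in> U" and i: "i \<in> imag_units" and j: "j \<in> imag_units"
  shows "slice_point j w \<in> U"
proof -
  define k where "k = (if Im w \<ge> 0 then j else - j)"
  have "k \<in> imag_units" using j by (simp add: k_def)
  moreover have "fst (slice_point i w) = Re w" "norm (snd (slice_point i w)) *\<^sub>R k = Im w *\<^sub>R j"
    using i by (simp_all add: slice_point_def k_def)
  ultimately have "slice_point j w \<in> axial_sphere (slice_point i w)"
    unfolding axial_sphere_def slice_point_def by force
  then show ?thesis using U by (auto simp: axially_symmetric_def)
qed

lemma slice_eq_plane_domain:
  assumes "axially_symmetric U" "j \<in> imag_units"
  shows "slice U j = plane_domain U"
  using assms slice_point_mem_all_units[OF assms(1)]
  by (auto simp: slice_def plane_domain_def)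

lemma slice_point_cnj: "slice_point j (cnj w) = slice_point (- j) w"
  by (simp add: slice_point_def)

lemma cnj_mem_plane_domain: "z \<in> plane_domain U \<Longrightarrow> cnj z \<in> plane_domain U"
  by (simp add: plane_domain_def slice_point_cnj)

lemma continuous_on_slice_point: "continuous_on A (slice_point j)"
  unfolding slice_point_def [abs_def] by (intro continuous_intros)

lemma open_slice: "open U \<Longrightarrow> open (slice U j)"
  using open_vimage[OF _ continuous_on_slice_point] by (simp add: slice_def vimage_def)

lemma bounded_slice:
  assumes "bounded U" "j \<in> imag_units"
  shows "bounded (slice U j)"
proof -
  from assms(1) obtain r where r: "\<And>x. x \<in> U \<Longrightarrow> norm x \<le> r" by (auto simp: bounded_iff)
  have "norm z \<le> r" if "z \<in> slice U j" for z
    using r[of "slice_point j z"] that norm_slice_point[OF assms(2)] by (simp add: slice_def)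
  then show ?thesis by (auto simp: bounded_iff)
qed

lemma closure_slice_subset: "closure (slice U j) \<subseteq> slice (closure U) j"
proof (rule closure_minimal)
  show "slice U j \<subseteq> slice (closure U) j"
    using closure_subset by (auto simp: slice_def)
  show "closed (slice (closure U) j)"
    using closed_vimage[OF closed_closure continuous_on_slice_point] by (simp add: slice_def vimage_def)
qed

lemma point_eq_slice_point:
  fixes x :: "'n::{finite,linorder} point"
  obtains i w where "i \<in> imag_units" "x = slice_point i w"
proof (cases "snd x = 0")
  case True
  have "norm (axis undefined 1 :: (real, 'n) vec) = 1" by (simp add: norm_axis_1)
  then show thesis
    using True by (intro that[of "axis undefined 1" "of_real (fst x)"])
      (auto simp: slice_point_def prod_eq_iff)
next
  case False
  then show thesis
    by (intro that[of "snd x /\<^sub>R norm (snd x)" "Complex (fst x) (norm (snd x))"])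
      (auto simp: slice_point_def prod_eq_iff)
qed

section \<open>The Cauchy formulas\<close>

text \<open>
  Multiplication by the constant factors of the representation formula is only real linear, and has to
  be taken out of the integral on either side; hence the general maps \<open>A\<close> and \<open>B\<close>.
\<close>

lemma form_integral_linear_combination:
  fixes \<omega>1 \<omega>2 :: "complex \<Rightarrow> complex \<Rightarrow> 'a::euclidean_space"
  assumes 1: "form_integrable_on_curves \<Gamma> \<omega>1" and 2: "form_integrable_on_curves \<Gamma> \<omega>2"
    and A: "bounded_linear A" and B: "bounded_linear B"
    and eq: "\<And>\<gamma> z w. \<gamma> \<in> \<Gamma> \<Longrightarrow> z \<in> path_image \<gamma> \<Longrightarrow> \<omega> z w = A (\<omega>1 z w) + B (\<omega>2 z w)"
  shows "form_integrable_on_curves \<Gamma> \<omega>"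
    and "form_integral_on_curves \<Gamma> \<omega> =
      A (form_integral_on_curves \<Gamma> \<omega>1) + B (form_integral_on_curves \<Gamma> \<omega>2)"
proof -
  let ?v = "\<lambda>\<gamma> t. vector_derivative \<gamma> (at t within {0..1})"
  have int: "((\<lambda>t. \<omega> (\<gamma> t) (?v \<gamma> t)) has_integral
      A (integral {0..1} (\<lambda>t. \<omega>1 (\<gamma> t) (?v \<gamma> t))) + B (integral {0..1} (\<lambda>t. \<omega>2 (\<gamma> t) (?v \<gamma> t)))) {0..1}"
    if g: "\<gamma> \<in> \<Gamma>" for \<gamma>
  proof -
    have "((\<lambda>t. A (\<omega>1 (\<gamma> t) (?v \<gamma> t)) + B (\<omega>2 (\<gamma> t) (?v \<gamma> t))) has_integral
      A (integral {0..1} (\<lambda>t. \<omega>1 (\<gamma> t) (?v \<gamma> t))) + B (integral {0..1} (\<lambda>t. \<omega>2 (\<gamma> t) (?v \<gamma> t)))) {0..1}"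
      using 1 2 g unfolding form_integrable_on_curves_def
      by (intro has_integral_add has_integral_linear[OF _ A, unfolded o_def]
          has_integral_linear[OF _ B, unfolded o_def] integrable_integral) auto
    then show ?thesis
      by (rule has_integral_eq[rotated]) (use eq[OF g] in \<open>simp add: path_image_def\<close>)
  qed
  then show "form_integrable_on_curves \<Gamma> \<omega>"
    unfolding form_integrable_on_curves_def by blast
  have "form_integral_on_curves \<Gamma> \<omega> =
      (\<Sum>\<gamma>\<in>\<Gamma>. A (integral {0..1} (\<lambda>t. \<omega>1 (\<gamma> t) (?v \<gamma> t))) +
        B (integral {0..1} (\<lambda>t. \<omega>2 (\<gamma> t) (?v \<gamma> t))))"
    unfolding form_integral_on_curves_def by (intro sum.cong refl integral_unique int)
  then show "form_integral_on_curves \<Gamma> \<omega> =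
      A (form_integral_on_curves \<Gamma> \<omega>1) + B (form_integral_on_curves \<Gamma> \<omega>2)"
    unfolding form_integral_on_curves_def
    by (simp add: sum.distrib linear_sum[OF bounded_linear.linear[OF A]]
        linear_sum[OF bounded_linear.linear[OF B]])
qed

lemma ds_unit_eq:
  assumes "j \<in> imag_units"
  shows "ds_unit j w = slice_number j (- \<i> * w)"
proof -
  have "- imag_unit j = slice_number j (- \<i>)" by (simp add: slice_number_eq)
  then show ?thesis
    unfolding ds_unit_def by (simp only: flip: slice_number_def slice_number_mult[OF assms]) (simp only: mult.commute)
qed

lemma bounded_linear_clifford_mult_left: "bounded_linear ((*) (a :: 'n::{finite,linorder} clifford))"
  unfolding linear_conv_bounded_linear[symmetric] by (rule linearI) (simp_all add: distrib_left)

lemma bounded_linear_clifford_mult_right: "bounded_linear (\<lambda>v. v * (a :: 'n::{finite,linorder} clifford))"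
  unfolding linear_conv_bounded_linear[symmetric] by (rule linearI) (simp_all add: distrib_right)

lemma complex_structure_left:
  assumes "j \<in> imag_units"
  shows "complex_structure ((*) (imag_unit j))"
proof (rule complex_structure.intro[OF bounded_linear_clifford_mult_left])
  show "imag_unit j * (imag_unit j * v) = - v" for v
    by (simp add: imag_unit_square[OF assms] flip: mult.assoc)
qed

lemma complex_structure_right:
  assumes "j \<in> imag_units"
  shows "complex_structure (\<lambda>v. v * imag_unit j)"
proof (rule complex_structure.intro[OF bounded_linear_clifford_mult_right])
  show "v * imag_unit j * imag_unit j = - v" for v
    by (simp add: imag_unit_square[OF assms] mult.assoc)
qed

text \<open>
  The representation formula splits the form for \<open>x\<close> into two forms for the points of \<open>\<complex>\<^sub>j\<close> on the
  sphere of \<open>x\<close>, to which the formula for polyanalytic functions applies. The same constant factors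
  recombine the two values of the slice function \<open>F\<close> into \<open>F x\<close>.
\<close>

lemma left_Cauchy_formula:
  fixes F :: "'n::{finite,linorder} point \<Rightarrow> 'n clifford"
  assumes W: "open W" "axially_symmetric W" and F: "left_poly_slice_monogenic M W F" and M: "M \<ge> 1"
    and U: "open U" "axially_symmetric U" "bounded U" "closure U \<subseteq> W"
    and j: "j \<in> imag_units" and bd: "positively_oriented_boundary (slice U j) \<Gamma>" and x: "x \<in> U"
  shows "form_integrable_on_curves \<Gamma> (left_Cauchy_form M F j x)"
    and "form_integral_on_curves \<Gamma> (left_Cauchy_form M F j x) = (2 * pi) *\<^sub>R F x"
proof -
  interpret J: complex_structure "(*) (imag_unit j)" by (rule complex_structure_left[OF j])
  have act: "J.act c v = slice_number j c * v" for c v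
    by (simp add: J.act_def slice_number_eq distrib_right)
  have dbar: "J.dbar = dbar_left j" and cr: "J.cr = cr_left j"
    by (simp_all add: fun_eq_iff J.dbar_def J.cr_def dbar_left_def cr_left_def)
  define D where "D = slice U j"
  define \<Omega> where "\<Omega> = plane_domain W"
  have \<Omega>: "open \<Omega>" using open_slice[OF W(1), of j] slice_eq_plane_domain[OF W(2) j] by (simp add: \<Omega>_def)
  have D: "bounded D" "open D" "closure D \<subseteq> \<Omega>"
  proof -
    show "bounded D" "open D" unfolding D_def using bounded_slice[OF U(3) j] open_slice[OF U(1)] by auto
    have "slice (closure U) j \<subseteq> slice W j" using U(4) by (auto simp: slice_def)
    then show "closure D \<subseteq> \<Omega>"
      unfolding D_def \<Omega>_def slice_eq_plane_domain[OF W(2) j, symmetric] using closure_slice_subset by blast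
  qed
  note bd = bd[folded D_def]
  obtain i w where i: "i \<in> imag_units" and w: "x = slice_point i w" by (rule point_eq_slice_point)
  have "w \<in> plane_domain U"
    using slice_point_mem_all_units[OF U(2) x[unfolded w] i] by (simp add: plane_domain_def)
  then have wD: "w \<in> D" "cnj w \<in> D"
    using cnj_mem_plane_domain[of w U] by (simp_all add: D_def slice_eq_plane_domain[OF U(2) j])
  then have w\<Omega>: "w \<in> \<Omega>" "cnj w \<in> \<Omega>" using D(3) closure_subset by blast+
  from F obtain F0 F1 where eo: "even_odd_on \<Omega> F0 F1"
    and FF: "\<And>z k. z \<in> \<Omega> \<Longrightarrow> k \<in> imag_units \<Longrightarrow> F (slice_point k z) = F0 z + imag_unit k * F1 z"
    and C: "class_C M \<Omega> F0" "class_C M \<Omega> F1"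
    and zero: "\<And>z. z \<in> \<Omega> \<Longrightarrow> (cr_left j ^^ M) (\<lambda>w. F0 w + imag_unit j * F1 w) z = 0"
    using j unfolding left_poly_slice_monogenic_def left_slice_function_def \<Omega>_def by fastforce
  define f where "f \<zeta> = F (slice_point j \<zeta>)" for \<zeta>
  have f: "f z = F0 z + imag_unit j * F1 z" if "z \<in> \<Omega>" for z
    using FF[OF that j] by (simp add: f_def)
  have C': "class_C M \<Omega> (\<lambda>z. F0 z + imag_unit j * F1 z)"
    by (intro class_C_add \<Omega> C class_C_bounded_linear[OF \<Omega> bounded_linear_clifford_mult_left])
  have Cf: "class_C M \<Omega> f"
    by (rule class_C_cong[OF \<Omega> _ C']) (simp add: f)
  have f0: "(J.dbar ^^ M) f z = 0" if "z \<in> \<Omega>" for z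
    using J.dbar_iterate_cong[OF \<Omega> f that, where l = M] zero[OF that]
      J.cr_iterate_eq_dbar_iterate[OF \<Omega> C' order_refl that] by (simp add: cr)
  define \<omega> where "\<omega> p z v = (\<Sum>l<M. J.act ((cnj p - cnj z) ^ l / (fact l * (z - p)) * (- \<i> * v))
      ((J.dbar ^^ l) f z))" for p z v
  have \<omega>: "form_integrable_on_curves \<Gamma> (\<omega> p)" "form_integral_on_curves \<Gamma> (\<omega> p) = (2 * pi) *\<^sub>R f p"
    if "p \<in> D" for p
    unfolding \<omega>_def [abs_def] using J.polyanalytic_Cauchy_formula[OF \<Omega> D bd M Cf f0 that] by auto
  define \<alpha> where "\<alpha> = (1/2) *\<^sub>R (1 - imag_unit i * imag_unit j)"
  define \<beta> where "\<beta> = (1/2) *\<^sub>R (1 + imag_unit i * imag_unit j)"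
  have eq: "left_Cauchy_form M F j x z v = \<alpha> * \<omega> w z v + \<beta> * \<omega> (cnj w) z v"
    if "\<gamma> \<in> \<Gamma>" "z \<in> path_image \<gamma>" for \<gamma> z v
  proof -
    have "z \<notin> D"
      using that bd D(2) by (auto simp: positively_oriented_boundary_def frontier_def interior_open)
    \<comment> \<open>The kernel is regular on the curves: they avoid \<open>D\<close>, which contains both points.\<close>
    then have "w \<noteq> z" "w \<noteq> cnj z" using wD by auto
    note Pi = Pi_SL_slice_points[OF j i this, folded \<alpha>_def \<beta>_def]
    define u where "u = - \<i> * v"
    have "Pi_SL l (slice_point j z) x * ds_unit j v * d =
        \<alpha> * (slice_number j (poly_kernel l z w * u) * d) +
        \<beta> * (slice_number j (poly_kernel l z (cnj w) * u) * d)" for l d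
      unfolding w Pi ds_unit_eq[OF j] u_def[symmetric] slice_number_mult[OF j]
      by (simp add: distrib_right mult.assoc)
    then show ?thesis
      unfolding left_Cauchy_form_def \<omega>_def act dbar f_def[abs_def] u_def[symmetric] poly_kernel_def[symmetric]
      by (simp add: sum.distrib sum_distrib_left)
  qed
  note comb = form_integral_linear_combination[OF \<omega>(1)[OF wD(1)] \<omega>(1)[OF wD(2)]
      bounded_linear_clifford_mult_left[of \<alpha>] bounded_linear_clifford_mult_left[of \<beta>]]
  show "form_integrable_on_curves \<Gamma> (left_Cauchy_form M F j x)"
    by (rule comb(1)) (rule eq)
  have "F0 (cnj w) = F0 w" "F1 (cnj w) = - F1 w"
    using eo w\<Omega> by (auto simp: even_odd_on_def)
  then have fw: "f w = F0 w + imag_unit j * F1 w" "f (cnj w) = F0 w - imag_unit j * F1 w"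
    using f w\<Omega> by auto
  have "\<alpha> + \<beta> = 1"
    using slice_number_via_left[OF j, of i 1] by (simp add: \<alpha>_def \<beta>_def)
  moreover have "\<alpha> * imag_unit j - \<beta> * imag_unit j = imag_unit i"
    using slice_number_via_left[OF j, of i \<i>] by (simp add: \<alpha>_def \<beta>_def slice_number_eq)
  moreover have "\<alpha> * f w + \<beta> * f (cnj w) =
      (\<alpha> + \<beta>) * F0 w + (\<alpha> * imag_unit j - \<beta> * imag_unit j) * F1 w"
    unfolding fw by (simp add: algebra_simps)
  ultimately have "\<alpha> * f w + \<beta> * f (cnj w) = F0 w + imag_unit i * F1 w"
    by simp
  also have "\<dots> = F x" using FF[OF w\<Omega>(1) i] w by simp
  finally have "\<alpha> * f w + \<beta> * f (cnj w) = F x" .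
  moreover have "form_integral_on_curves \<Gamma> (left_Cauchy_form M F j x) =
      \<alpha> * form_integral_on_curves \<Gamma> (\<omega> w) + \<beta> * form_integral_on_curves \<Gamma> (\<omega> (cnj w))"
    by (rule comb(2)) (rule eq)
  ultimately show "form_integral_on_curves \<Gamma> (left_Cauchy_form M F j x) = (2 * pi) *\<^sub>R F x"
    unfolding \<omega>(2)[OF wD(1)] \<omega>(2)[OF wD(2)] by (simp flip: scaleR_add_right)
qed

text \<open>
  The mirror image: now \<open>J\<close> multiplies from the right, and the constant factors of the representation
  formula end up at the right end of the form, next to the kernel.
\<close>

lemma right_Cauchy_formula:
  fixes F :: "'n::{finite,linorder} point \<Rightarrow> 'n clifford"
  assumes W: "open W" "axially_symmetric W" and F: "right_poly_slice_monogenic M W F" and M: "M \<ge> 1"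
    and U: "open U" "axially_symmetric U" "bounded U" "closure U \<subseteq> W"
    and j: "j \<in> imag_units" and bd: "positively_oriented_boundary (slice U j) \<Gamma>" and x: "x \<in> U"
  shows "form_integrable_on_curves \<Gamma> (right_Cauchy_form M F j x)"
    and "form_integral_on_curves \<Gamma> (right_Cauchy_form M F j x) = (2 * pi) *\<^sub>R F x"
proof -
  interpret J: complex_structure "\<lambda>v. v * imag_unit j" by (rule complex_structure_right[OF j])
  have act: "J.act c v = v * slice_number j c" for c v
    by (simp add: J.act_def slice_number_eq distrib_left)
  have dbar: "J.dbar = dbar_right j" and cr: "J.cr = cr_right j"
    by (simp_all add: fun_eq_iff J.dbar_def J.cr_def dbar_right_def cr_right_def)
  define D where "D = slice U j"
  define \<Omega> where "\<Omega> = plane_domain W"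
  have \<Omega>: "open \<Omega>" using open_slice[OF W(1), of j] slice_eq_plane_domain[OF W(2) j] by (simp add: \<Omega>_def)
  have D: "bounded D" "open D" "closure D \<subseteq> \<Omega>"
  proof -
    show "bounded D" "open D" unfolding D_def using bounded_slice[OF U(3) j] open_slice[OF U(1)] by auto
    have "slice (closure U) j \<subseteq> slice W j" using U(4) by (auto simp: slice_def)
    then show "closure D \<subseteq> \<Omega>"
      unfolding D_def \<Omega>_def slice_eq_plane_domain[OF W(2) j, symmetric] using closure_slice_subset by blast
  qed
  note bd = bd[folded D_def]
  obtain i w where i: "i \<in> imag_units" and w: "x = slice_point i w" by (rule point_eq_slice_point)
  have "w \<in> plane_domain U"
    using slice_point_mem_all_units[OF U(2) x[unfolded w] i] by (simp add: plane_domain_def)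
  then have wD: "w \<in> D" "cnj w \<in> D"
    using cnj_mem_plane_domain[of w U] by (simp_all add: D_def slice_eq_plane_domain[OF U(2) j])
  then have w\<Omega>: "w \<in> \<Omega>" "cnj w \<in> \<Omega>" using D(3) closure_subset by blast+
  from F obtain F0 F1 where eo: "even_odd_on \<Omega> F0 F1"
    and FF: "\<And>z k. z \<in> \<Omega> \<Longrightarrow> k \<in> imag_units \<Longrightarrow> F (slice_point k z) = F0 z + F1 z * imag_unit k"
    and C: "class_C M \<Omega> F0" "class_C M \<Omega> F1"
    and zero: "\<And>z. z \<in> \<Omega> \<Longrightarrow> (cr_right j ^^ M) (\<lambda>w. F0 w + F1 w * imag_unit j) z = 0"
    using j unfolding right_poly_slice_monogenic_def right_slice_function_def \<Omega>_def by fastforce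
  define f where "f \<zeta> = F (slice_point j \<zeta>)" for \<zeta>
  have f: "f z = F0 z + F1 z * imag_unit j" if "z \<in> \<Omega>" for z
    using FF[OF that j] by (simp add: f_def)
  have C': "class_C M \<Omega> (\<lambda>z. F0 z + F1 z * imag_unit j)"
    by (intro class_C_add \<Omega> C class_C_bounded_linear[OF \<Omega> bounded_linear_clifford_mult_right])
  have Cf: "class_C M \<Omega> f"
    by (rule class_C_cong[OF \<Omega> _ C']) (simp add: f)
  have f0: "(J.dbar ^^ M) f z = 0" if "z \<in> \<Omega>" for z
    using J.dbar_iterate_cong[OF \<Omega> f that, where l = M] zero[OF that]
      J.cr_iterate_eq_dbar_iterate[OF \<Omega> C' order_refl that] by (simp add: cr)
  define \<omega> where "\<omega> p z v = (\<Sum>l<M. J.act ((cnj p - cnj z) ^ l / (fact l * (z - p)) * (- \<i> * v))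
      ((J.dbar ^^ l) f z))" for p z v
  have \<omega>: "form_integrable_on_curves \<Gamma> (\<omega> p)" "form_integral_on_curves \<Gamma> (\<omega> p) = (2 * pi) *\<^sub>R f p"
    if "p \<in> D" for p
    unfolding \<omega>_def [abs_def] using J.polyanalytic_Cauchy_formula[OF \<Omega> D bd M Cf f0 that] by auto
  define \<alpha> where "\<alpha> = (1/2) *\<^sub>R (1 - imag_unit j * imag_unit i)"
  define \<beta> where "\<beta> = (1/2) *\<^sub>R (1 + imag_unit j * imag_unit i)"
  have eq: "right_Cauchy_form M F j x z v = \<omega> w z v * \<alpha> + \<omega> (cnj w) z v * \<beta>"
    if "\<gamma> \<in> \<Gamma>" "z \<in> path_image \<gamma>" for \<gamma> z v
  proof -
    have "z \<notin> D"
      using that bd D(2) by (auto simp: positively_oriented_boundary_def frontier_def interior_open)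
    \<comment> \<open>The kernel is regular on the curves: they avoid \<open>D\<close>, which contains both points.\<close>
    then have "w \<noteq> z" "w \<noteq> cnj z" using wD by auto
    note Pi = Pi_SR_slice_points[OF j i this, folded \<alpha>_def \<beta>_def]
    define u where "u = - \<i> * v"
    have "d * ds_unit j v * Pi_SR l (slice_point j z) x =
        d * slice_number j (poly_kernel l z w * u) * \<alpha> +
        d * slice_number j (poly_kernel l z (cnj w) * u) * \<beta>" for l d
      unfolding w Pi ds_unit_eq[OF j] u_def[symmetric] mult.commute[of _ u] slice_number_mult[OF j]
      by (simp add: distrib_left mult.assoc)
    then show ?thesis
      unfolding right_Cauchy_form_def \<omega>_def act dbar f_def[abs_def] u_def[symmetric] poly_kernel_def[symmetric]
      by (simp add: sum.distrib sum_distrib_right)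
  qed
  note comb = form_integral_linear_combination[OF \<omega>(1)[OF wD(1)] \<omega>(1)[OF wD(2)]
      bounded_linear_clifford_mult_right[of \<alpha>] bounded_linear_clifford_mult_right[of \<beta>]]
  show "form_integrable_on_curves \<Gamma> (right_Cauchy_form M F j x)"
    by (rule comb(1)) (rule eq)
  have "F0 (cnj w) = F0 w" "F1 (cnj w) = - F1 w"
    using eo w\<Omega> by (auto simp: even_odd_on_def)
  then have fw: "f w = F0 w + F1 w * imag_unit j" "f (cnj w) = F0 w - F1 w * imag_unit j"
    using f w\<Omega> by auto
  have "\<alpha> + \<beta> = 1"
    using slice_number_via_right[OF j, of i 1] by (simp add: \<alpha>_def \<beta>_def)
  moreover have "imag_unit j * \<alpha> - imag_unit j * \<beta> = imag_unit i"
    using slice_number_via_right[OF j, of i \<i>] by (simp add: \<alpha>_def \<beta>_def slice_number_eq)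
  moreover have "f w * \<alpha> + f (cnj w) * \<beta> =
      F0 w * (\<alpha> + \<beta>) + F1 w * (imag_unit j * \<alpha> - imag_unit j * \<beta>)"
    unfolding fw by (simp add: algebra_simps)
  ultimately have "f w * \<alpha> + f (cnj w) * \<beta> = F0 w + F1 w * imag_unit i"
    by simp
  also have "\<dots> = F x" using FF[OF w\<Omega>(1) i] w by simp
  finally have "f w * \<alpha> + f (cnj w) * \<beta> = F x" .
  moreover have "form_integral_on_curves \<Gamma> (right_Cauchy_form M F j x) =
      form_integral_on_curves \<Gamma> (\<omega> w) * \<alpha> + form_integral_on_curves \<Gamma> (\<omega> (cnj w)) * \<beta>"
    by (rule comb(2)) (rule eq)
  ultimately show "form_integral_on_curves \<Gamma> (right_Cauchy_form M F j x) = (2 * pi) *\<^sub>R F x"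
    unfolding \<omega>(2)[OF wD(1)] \<omega>(2)[OF wD(2)] by (simp flip: scaleR_add_right)
qed

theorem theorem4p12:
  fixes M :: nat
    and U :: "'n::{finite,linorder} point set"
  assumes "M \<ge> 1"
    and "bounded U"
    and "slice_Cauchy_domain U"
  shows
    "(\<forall>F W. open W \<and> axially_symmetric W \<and> closure U \<subseteq> W \<and> left_poly_slice_monogenic M W F \<longrightarrow>
        (\<forall>j\<in>imag_units. \<forall>\<Gamma>. positively_oriented_boundary (slice U j) \<Gamma> \<longrightarrow> (\<forall>x\<in>U.
           form_integrable_on_curves \<Gamma> (left_Cauchy_form M F j x) \<and>
           F x = (1 / (2 * pi)) *\<^sub>R form_integral_on_curves \<Gamma> (left_Cauchy_form M F j x))) \<and>
        (\<forall>U' j j' \<Gamma> \<Gamma>' x.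
           bounded U' \<and> slice_Cauchy_domain U' \<and> closure U' \<subseteq> W \<and>
           j \<in> imag_units \<and> positively_oriented_boundary (slice U j) \<Gamma> \<and>
           j' \<in> imag_units \<and> positively_oriented_boundary (slice U' j') \<Gamma>' \<and> x \<in> U \<inter> U' \<longrightarrow>
           form_integral_on_curves \<Gamma> (left_Cauchy_form M F j x) =
           form_integral_on_curves \<Gamma>' (left_Cauchy_form M F j' x))) \<and>
     (\<forall>F W. open W \<and> axially_symmetric W \<and> closure U \<subseteq> W \<and> right_poly_slice_monogenic M W F \<longrightarrow>
        (\<forall>j\<in>imag_units. \<forall>\<Gamma>. positively_oriented_boundary (slice U j) \<Gamma> \<longrightarrow> (\<forall>x\<in>U.
           form_integrable_on_curves \<Gamma> (right_Cauchy_form M F j x) \<and>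
           F x = (1 / (2 * pi)) *\<^sub>R form_integral_on_curves \<Gamma> (right_Cauchy_form M F j x))) \<and>
        (\<forall>U' j j' \<Gamma> \<Gamma>' x.
           bounded U' \<and> slice_Cauchy_domain U' \<and> closure U' \<subseteq> W \<and>
           j \<in> imag_units \<and> positively_oriented_boundary (slice U j) \<Gamma> \<and>
           j' \<in> imag_units \<and> positively_oriented_boundary (slice U' j') \<Gamma>' \<and> x \<in> U \<inter> U' \<longrightarrow>
           form_integral_on_curves \<Gamma> (right_Cauchy_form M F j x) =
           form_integral_on_curves \<Gamma>' (right_Cauchy_form M F j' x)))"
proof -
  have left: "form_integrable_on_curves \<Gamma> (left_Cauchy_form M F j x) \<and>
      form_integral_on_curves \<Gamma> (left_Cauchy_form M F j x) = (2 * pi) *\<^sub>R F x"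
    if "open W \<and> axially_symmetric W \<and> left_poly_slice_monogenic M W F"
      "bounded V" "slice_Cauchy_domain V" "closure V \<subseteq> W" "j \<in> imag_units"
      "positively_oriented_boundary (slice V j) \<Gamma>" "x \<in> V"
    for F W V j \<Gamma> and x :: "'n point"
    using left_Cauchy_formula[of W M F V j \<Gamma> x] that \<open>M \<ge> 1\<close>
    by (simp add: slice_Cauchy_domain_def)
  have right: "form_integrable_on_curves \<Gamma> (right_Cauchy_form M F j x) \<and>
      form_integral_on_curves \<Gamma> (right_Cauchy_form M F j x) = (2 * pi) *\<^sub>R F x"
    if "open W \<and> axially_symmetric W \<and> right_poly_slice_monogenic M W F"
      "bounded V" "slice_Cauchy_domain V" "closure V \<subseteq> W" "j \<in> imag_units"
      "positively_oriented_boundary (slice V j) \<Gamma>" "x \<in> V"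
    for F W V j \<Gamma> and x :: "'n point"
    using right_Cauchy_formula[of W M F V j \<Gamma> x] that \<open>M \<ge> 1\<close>
    by (simp add: slice_Cauchy_domain_def)
  show ?thesis
    by (intro conjI allI ballI impI; (elim conjE IntE)?) (use assms(2,3) in \<open>simp_all add: left right\<close>)
qed

end
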